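(* Let $h:\{1,2,3,\dots\}\to(0,\infty)$ be a decreasing function such that $\sum_{k=1}^\infty\frac{h(k)}{k}<\infty$, and set $$S_h(n):=\sum_{k=1}^n\frac{1}{k\cdot h(k)}.$$ Then $$\mathcal{Q}_{\mathrm{rand}}(\epsilon)=\Omega\left(\frac{1}{\sqrt\epsilon\cdot S_h\left(\left\lceil\frac{1}{\sqrt\epsilon}\right\rceil\right)}\right)\quad\text{as }\epsilon\to0,$$ i.e. there are constants $c,\epsilon_0>0$ (depending only on $h$) such that $\mathcal{Q}_{\mathrm{rand}}(\epsilon)\ge \frac{c}{\sqrt\epsilon\, S_h(\lceil 1/\sqrt\epsilon\rceil)}$ for all $\epsilon\in(0,\epsilon_0)$.
   Context: A function $f:[0,1]^2\to\mathbb{R}$ is called smooth if it is differentiable and $\|\nabla f(x)-\nabla f(y)\|_2\le\|x-y\|_2$ for all $x,y\in[0,1]^2$. A point $x\in[0,1]^2$ is an $\epsilon$-stationary point of $f$ if for every $\epsilon'>\epsilon$ there is a neighborhood $N\subset[0,1]^2$ of $x$ in $[0,1]^2$ such that $f(x)\le f(y)+\epsilon'\|x-y\|_2$ for all $y\in N$ (for $x\in(0,1)^2$ this means $\|\nabla f(x)\|_2\le\epsilon$). Query model: a deterministic algorithm adaptively chooses points $x\in[0,1]^2$ (each as a function of the previous answers), receives for each the exact value $f(x)$, and eventually stops and outputs a point. A randomized algorithm is a random choice of a deterministic algorithm (made independently of $f$). For an algorithm $\mathcal{A}$, a smooth $f$ and $\epsilon>0$, $\mathcal{Q}(\mathcal{A},f,\epsilon)$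 is the number of queries made by $\mathcal{A}$ in order to find an $\epsilon$-stationary point of $f$ (that is, before it stops and outputs an $\epsilon$-stationary point; $+\infty$ if it does not). Then $$\mathcal{Q}_{\mathrm{rand}}(\epsilon):=\inf_{\mathcal{A}\text{ randomized}}\ \sup_{f}\ \mathbb{E}_{\mathcal{A}}\left[\mathcal{Q}(\mathcal{A},f,\epsilon)\right],$$ where the infimum is over all randomized algorithms, the supremum over all smooth $f:[0,1]^2\to\mathbb{R}$, and the expectation is over the randomness of $\mathcal{A}$. *)

theory Defs
  imports "HOL-Probability.Probability"
begin

(* The norm and inner product of the type real * real are the Euclidean ones. *)
definition unit_square :: "(real \<times> real) set" where
  "unit_square = {0..1} \<times> {0..1}"

(* Derivatives are taken within the square, so boundary points are covered (one-sidedly);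
   the gradient g is uniquely determined at every point of the square, corners included.
   Values of f outside the square play no role. *)
definition smooth :: "(real \<times> real \<Rightarrow> real) \<Rightarrow> bool" where
  "smooth f \<longleftrightarrow>
     (\<exists>g :: real \<times> real \<Rightarrow> real \<times> real.
        (\<forall>x\<in>unit_square. (f has_derivative (\<lambda>v. g x \<bullet> v)) (at x within unit_square)) \<and>
        (\<forall>x\<in>unit_square. \<forall>y\<in>unit_square. norm (g x - g y) \<le> norm (x - y)))"

definition stationary_point :: "real \<Rightarrow> (real \<times> real \<Rightarrow> real) \<Rightarrow> real \<times> real \<Rightarrow> bool" where
  "stationary_point \<epsilon> f x \<longleftrightarrow>
     x \<in> unit_square \<and>
     (\<forall>\<epsilon>'>\<epsilon>. \<exists>N. openin (top_of_set unit_square) N \<and> x \<in> N \<and>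
        (\<forall>y\<in>N. f x \<le> f y + \<epsilon>' * norm (x - y)))"

datatype action = Query "real \<times> real" | Output "real \<times> real"

(* A deterministic algorithm maps the list of answers received so far (oldest first) to its
   next action. It may run forever; this is penalised by an infinite cost below. *)
type_synonym algorithm = "real list \<Rightarrow> action"

definition det_algorithms :: "algorithm set" where
  "det_algorithms =
     {A. \<forall>as. case A as of Query x \<Rightarrow> x \<in> unit_square | Output x \<Rightarrow> x \<in> unit_square}"

(* The answers after n steps; the list no longer changes once the algorithm has stopped. *)
primrec answers :: "algorithm \<Rightarrow> (real \<times> real \<Rightarrow> real) \<Rightarrow> nat \<Rightarrow> real list" where
  "answers A f 0 = []"
| "answers A f (Suc n) =
     (case A (answers A f n) of
        Query x \<Rightarrow> answers A f n @ [f x]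
      | Output x \<Rightarrow> answers A f n)"

definition stops_with ::
    "algorithm \<Rightarrow> (real \<times> real \<Rightarrow> real) \<Rightarrow> nat \<Rightarrow> real \<times> real \<Rightarrow> bool" where
  "stops_with A f n x \<longleftrightarrow>
     (\<forall>m<n. \<exists>y. A (answers A f m) = Query y) \<and> A (answers A f n) = Output x"

lemma stops_with_unique:
  assumes "stops_with A f n x" "stops_with A f m y"
  shows "n = m \<and> x = y"
proof -
  have "n = m"
    using assms unfolding stops_with_def by (metis action.distinct(1) linorder_neqE_nat)
  then show ?thesis
    using assms by (simp add: stops_with_def)
qed

(* By stops_with_unique the set below has at most one element, and it is empty iff A does not
   stop at an \<epsilon>-stationary point, in which case the infimum in ennreal is \<infinity>. *)
definition query_cost :: "algorithm \<Rightarrow> (real \<times> real \<Rightarrow> real) \<Rightarrow> real \<Rightarrow> ennreal" where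
  "query_cost A f \<epsilon> = Inf {of_nat n | n x. stops_with A f n x \<and> stationary_point \<epsilon> f x}"

(* A randomized algorithm is a probability measure on deterministic algorithms. No sigma-algebra
   on algorithms is prescribed: we only ask that the cost be a random variable for every smooth
   f, so that its expectation is meaningful. A random algorithm defined on any other probability
   space induces such a measure (its image measure), so nothing is lost. *)
definition rand_algorithms :: "real \<Rightarrow> algorithm measure set" where
  "rand_algorithms \<epsilon> =
     {M. prob_space M \<and> space M \<subseteq> det_algorithms \<and>
         (\<forall>f. smooth f \<longrightarrow> (\<lambda>A. query_cost A f \<epsilon>) \<in> borel_measurable M)}"

definition Q_rand :: "real \<Rightarrow> ennreal" where
  "Q_rand \<epsilon> =
     (INF M\<in>rand_algorithms \<epsilon>. SUP f\<in>{f. smooth f}. \<integral>\<^sup>+A. query_cost A f \<epsilon> \<partial>M)"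

definition S :: "(nat \<Rightarrow> real) \<Rightarrow> nat \<Rightarrow> real" where
  "S h n = (\<Sum>k=1..n. 1 / (real k * h k))"

end

theory Submission imports Defs
begin

text \<open>
  On a grid of mesh \<open>1 / n \<sim> \<surd>\<epsilon>\<close> one can carve into a tilted plane a valley of width
  \<open>1 / n\<close> that follows an arbitrary monotone lattice path and descends along it, so that the only
  \<open>\<epsilon>\<close>-stationary points lie at the far end of the path, and a query reveals something only if it
  hits the valley. The path is chosen at random and unpredictably, in the spirit of Haeggstroem and
  Mossel: given its first \<open>l\<close> steps, its position at time \<open>l + k\<close> takes any value with
  probability at most \<open>C / (k h(k))\<close>; this is possible because \<open>\<Sum> h(2\<^sup>j)\<close> converges.

  Fix \<open>l\<close> and the first \<open>l\<close> steps. Until the first query that hits the path beyond row \<open>l\<close>, the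
  queries are determined, and each of them, in row \<open>l + k\<close>, is a hit with conditional probability
  \<open>O(1 / (k h(k)))\<close>. Hence the sum of these bounds over the queries actually made has expectation at
  least \<open>1/4\<close>. Summing over \<open>l < n\<close>, each query contributes at most
  \<open>\<Sum>\<^sub>k O(1 / (k h(k))) = O(S\<^sub>h(n))\<close>, so the expected number of queries is of order at
  least \<open>n / S\<^sub>h(n)\<close>.
\<close>

section \<open>Unpredictable paths\<close>

text \<open>Greedy choice as for Kraft's inequality: the residues modulo \<open>2 ^ j\<close>
  outside all classes of lower levels have density \<open>1 - (\<Sum>i<j. D i / 2 ^ i)\<close>,
  which leaves room for \<open>D j\<close> more. The bijection \<open>e j\<close> ranks the chosen
  ones.\<close>

lemma residue_classes:
  fixes D :: "nat \<Rightarrow> nat"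
  assumes "\<And>j. (\<Sum>i\<le>j. real (D i) / 2 ^ i) \<le> 1"
  obtains R :: "nat \<Rightarrow> nat set" and e :: "nat \<Rightarrow> nat \<Rightarrow> nat"
  where "\<And>j. R j \<subseteq> {..<2 ^ j}" "\<And>j. bij_betw (e j) (R j) {..<D j}"
    "\<And>i j t. i < j \<Longrightarrow> t mod 2 ^ j \<in> R j \<Longrightarrow> t mod 2 ^ i \<notin> R i"
proof -
  define pick where "pick = (\<lambda>j A. SOME B::nat set. B \<subseteq> A \<and> card B = D j)"
  \<comment> \<open>\<open>U j\<close> holds the residues modulo \<open>2 ^ j\<close> still free
    when level \<open>j\<close> chooses; the leftovers are lifted to modulus
    \<open>2 ^ Suc j\<close>, where each residue splits in two.\<close>
  define U where
    "U = rec_nat {0} (\<lambda>j A. {x. x < 2 ^ Suc j \<and> x mod 2 ^ j \<in> A - pick j A})"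
  define R where "R = (\<lambda>j. pick j (U j))"
  have U0: "U 0 = {0}" and US: "U (Suc j) = {x. x < 2 ^ Suc j \<and> x mod 2 ^ j \<in> U j - R j}" for j
    unfolding U_def R_def by simp_all
  have Usub: "U j \<subseteq> {..<2 ^ j}" for j
    by (cases j) (auto simp: U0 US)
  then have finU: "finite (U j)" for j
    using finite_subset by blast
  have R_props: "R j \<subseteq> U j \<and> card (R j) = D j" if "D j \<le> card (U j)" for j
  proof -
    from obtain_subset_with_card_n[OF that] obtain B where "B \<subseteq> U j" "card B = D j"
      by blast
    then show ?thesis
      unfolding R_def pick_def by (intro someI[of "\<lambda>B. B \<subseteq> U j \<and> card B = D j" B]) auto
  qed
  have card_double: "card {x. x < 2 ^ Suc j \<and> x mod 2 ^ j \<in> A} = 2 * card A"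
    if "A \<subseteq> {..<2 ^ j}" for A :: "nat set" and j :: nat
  proof -
    have "{x. x < 2 ^ Suc j \<and> x mod 2 ^ j \<in> A} = A \<union> (\<lambda>x. x + 2 ^ j) ` A"
    proof (intro set_eqI iffI)
      fix x assume x: "x \<in> {x. x < 2 ^ Suc j \<and> x mod 2 ^ j \<in> A}"
      show "x \<in> A \<union> (\<lambda>x. x + 2 ^ j) ` A"
      proof (cases "x < 2 ^ j")
        case True
        then show ?thesis using x by simp
      next
        case False
        then have "x mod 2 ^ j = x - 2 ^ j" "x = (x - 2 ^ j) + 2 ^ j"
          using x by (auto simp: le_mod_geq)
        moreover from this have "x - 2 ^ j \<in> A" using x by simp
        ultimately show ?thesis by blast
      qed
    next
      fix x assume "x \<in> A \<union> (\<lambda>x. x + 2 ^ j) ` A"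
      then show "x \<in> {x. x < 2 ^ Suc j \<and> x mod 2 ^ j \<in> A}"
        using that by fastforce
    qed
    moreover have "A \<inter> (\<lambda>x. x + 2 ^ j) ` A = {}"
      using that by auto
    moreover have "finite A"
      using that finite_subset by blast
    ultimately show ?thesis
      by (simp add: card_Un_disjoint card_image)
  qed
  have cardU: "real (card (U j)) = 2 ^ j * (1 - (\<Sum>i<j. real (D i) / 2 ^ i))" for j
  proof (induction j)
    case 0
    then show ?case by (simp add: U0)
  next
    case (Suc j)
    have "real (D j) / 2 ^ j \<le> 1 - (\<Sum>i<j. real (D i) / 2 ^ i)"
      using assms[of j] by (simp add: lessThan_Suc_atMost[symmetric])
    then have "real (D j) \<le> real (card (U j))"
      unfolding Suc by (simp add: field_simps)
    then have le: "D j \<le> card (U j)" by simp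
    have "card (U (Suc j)) = 2 * card (U j - R j)"
      unfolding US by (rule card_double) (use Usub in auto)
    also have "card (U j - R j) = card (U j) - D j"
      using R_props[OF le] finU[of j] by (metis card_Diff_subset finite_subset)
    finally have "real (card (U (Suc j))) = 2 * (real (card (U j)) - real (D j))"
      using le by simp
    then show ?case
      unfolding Suc by (simp add: right_diff_distrib distrib_left)
  qed
  have le: "D j \<le> card (U j)" for j
  proof -
    have "real (D j) / 2 ^ j \<le> 1 - (\<Sum>i<j. real (D i) / 2 ^ i)"
      using assms[of j] by (simp add: lessThan_Suc_atMost[symmetric])
    then have "real (D j) \<le> real (card (U j))"
      unfolding cardU by (simp add: field_simps)
    then show ?thesis by simp
  qed
  have sub: "R j \<subseteq> U j" and cardR: "card (R j) = D j" for j
    using R_props[OF le] by auto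
  have desc: "t mod 2 ^ i \<in> U i - R i" if "i < j" "t mod 2 ^ j \<in> U j" for i j t
    using that
  proof (induction j arbitrary: i)
    case (Suc j)
    have "t mod 2 ^ Suc j mod 2 ^ j = t mod 2 ^ j"
      by (simp add: mod_mod_cancel)
    then have "t mod 2 ^ j \<in> U j - R j"
      using Suc.prems(2) unfolding US by auto
    then show ?case
      using Suc.IH[of i] Suc.prems(1) by (cases "i = j") auto
  qed simp
  have "\<exists>e. bij_betw e (R j) {..<D j}" for j
    using finite_same_card_bij[of "R j" "{..<D j}"] cardR finite_subset[OF sub finU] by auto
  then obtain e where "\<And>j. bij_betw (e j) (R j) {..<D j}"
    by metis
  with that[of R e] sub Usub desc show thesis
    by blast
qed

definition height :: "(nat \<Rightarrow> bool) \<Rightarrow> nat \<Rightarrow> nat" where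
  "height s i = (\<Sum>t<i. of_bool (s t))"

text \<open>Rounding \<open>l\<close> up to a multiple of \<open>2 ^ j\<close> loses at most
  \<open>2 ^ j - 1\<close>, so a block fits as soon as \<open>2 * 2 ^ j - 1 \<le> k\<close>; the
  largest such \<open>j\<close> is \<open>floor_log (k + 1) - 1\<close>.\<close>

lemma aligned_block:
  assumes "k \<ge> 1"
  obtains j b :: nat where "l \<le> b * 2 ^ j" "Suc b * 2 ^ j \<le> l + k" "2 ^ j \<le> k" "k < 4 * 2 ^ j"
proof -
  define j where "j = floor_log (k + 1) - 1"
  have pos: "floor_log (k + 1) \<ge> 1"
    using assms floor_log_rec[of "k + 1"] by simp
  have "2 ^ floor_log (k + 1) \<le> k + 1" "k + 1 < 2 * 2 ^ floor_log (k + 1)"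
    using floor_log_exp2_le[of "k+1"] floor_log_exp2_gt[of "k+1"] by auto
  moreover have "(2::nat) ^ floor_log (k + 1) = 2 * 2 ^ j"
    using pos unfolding j_def by (metis One_nat_def Suc_pred less_eq_Suc_le power_Suc)
  ultimately have j: "2 * 2 ^ j \<le> k + 1" "k + 1 < 4 * 2 ^ j" by auto
  define b where "b = (l + 2 ^ j - 1) div 2 ^ j"
  have p: "(2::nat) ^ j \<ge> 1" by simp
  have "b * 2 ^ j + (l + 2 ^ j - 1) mod 2 ^ j = l + 2 ^ j - 1"
    unfolding b_def by (rule div_mult_mod_eq)
  moreover have "(l + 2 ^ j - 1) mod 2 ^ j < 2 ^ j" by simp
  ultimately have "l \<le> b * 2 ^ j" "b * 2 ^ j \<le> l + 2 ^ j - 1"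
    using p by linarith+
  with j p show thesis
    by (intro that[of b j]) auto
qed

text \<open>Conditional probabilities under the uniform choice from \<open>\<Omega>\<close> are
  written as cardinalities cleared of denominators, so an empty class is no exception.\<close>

locale unpredictable_family =
  fixes \<Omega> :: "'w set" and s :: "'w \<Rightarrow> nat \<Rightarrow> bool" and C :: real and h :: "nat \<Rightarrow> real" and n :: nat
  assumes finite_family: "finite \<Omega>" and nonempty: "\<Omega> \<noteq> {}" and C_pos: "0 < C"
    and h_pos: "\<And>k. 1 \<le> k \<Longrightarrow> 0 < h k"
    and unpredictable: "\<And>l r x v. l < r \<Longrightarrow> r \<le> n \<Longrightarrow>
          real (card {\<omega>\<in>\<Omega>. (\<forall>t<l. s \<omega> t = v t) \<and> height (s \<omega>) r = x})
            \<le> C / (real (r - l) * h (r - l)) * real (card {\<omega>\<in>\<Omega>. \<forall>t<l. s \<omega> t = v t})"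

text \<open>Convergence of the sum \<open>H\<close> of the \<open>h (2 ^ j)\<close> makes room for
  classes of density about \<open>h (2 ^ j) / H\<close>. A gap \<open>k\<close> contains an aligned
  block longer than \<open>k / 4\<close>, whose coordinate alone yields the bound
  \<open>1 / (D j + 1)\<close>; hence \<open>C = 4 * H\<close> for every \<open>n\<close>.\<close>

lemma unpredictable_paths:
  fixes h :: "nat \<Rightarrow> real"
  assumes pos: "\<And>k. 1 \<le> k \<Longrightarrow> 0 < h k"
    and dec: "\<And>k l. 1 \<le> k \<Longrightarrow> k \<le> l \<Longrightarrow> h l \<le> h k"
    and summ: "summable (\<lambda>j. h (2 ^ j))"
  obtains C where "C > 0"
    "\<And>n. \<exists>(\<Omega> :: (nat \<times> nat \<Rightarrow> nat) set) s. unpredictable_family \<Omega> s C h n"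
proof -
  define H where "H = (\<Sum>j. h (2 ^ j))"
  have hpos: "h (2 ^ j) > 0" for j using pos by simp
  have H: "H > 0" "\<And>j. (\<Sum>i\<le>j. h (2 ^ i)) \<le> H"
    unfolding H_def using suminf_pos[OF summ] hpos sum_le_suminf[OF summ] by (auto intro: less_imp_le)
  \<comment> \<open>Rounding down keeps the densities summing to at most 1; the loss is made up by
    the \<open>D j + 1\<close> values of a coordinate, see \<open>Dgt\<close>.\<close>
  define D where "D = (\<lambda>j. nat \<lfloor>h (2 ^ j) / H * 2 ^ j\<rfloor>)"
  have Dle: "real (D j) \<le> h (2 ^ j) / H * 2 ^ j" for j
    unfolding D_def using hpos[of j] H(1) by (simp add: of_nat_floor)
  have Dgt: "h (2 ^ j) / H * 2 ^ j < real (D j + 1)" for j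
    unfolding D_def by linarith
  have "(\<Sum>i\<le>j. real (D i) / 2 ^ i) \<le> 1" for j
  proof -
    have "(\<Sum>i\<le>j. real (D i) / 2 ^ i) \<le> (\<Sum>i\<le>j. h (2 ^ i) / H)"
      using Dle by (intro sum_mono) (simp add: divide_le_eq)
    also have "\<dots> = (\<Sum>i\<le>j. h (2 ^ i)) / H" by (simp add: sum_divide_distrib)
    also have "\<dots> \<le> 1" using H by simp
    finally show ?thesis .
  qed
  from residue_classes[OF this] obtain R :: "nat \<Rightarrow> nat set" and e where
    R: "\<And>j. R j \<subseteq> {..<2 ^ j}" and e: "\<And>j. bij_betw (e j) (R j) {..<D j}"
    and disj: "\<And>i j t. i < j \<Longrightarrow> t mod 2 ^ j \<in> R j \<Longrightarrow> t mod 2 ^ i \<notin> R i"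
    by metis
  \<comment> \<open>The coordinate \<open>(j, b)\<close> of \<open>\<omega>\<close>, uniform in \<open>{0..D j}\<close>, is the number of up-steps among
    the sites of class \<open>j\<close> in the \<open>b\<close>-th dyadic block of length \<open>2 ^ j\<close>. A block that starts
    after time \<open>l\<close> thus spreads the later heights evenly over \<open>D j + 1\<close> values.\<close>
  define s :: "(nat \<times> nat \<Rightarrow> nat) \<Rightarrow> nat \<Rightarrow> bool" where
    "s = (\<lambda>\<omega> t. \<exists>j. t mod 2 ^ j \<in> R j \<and> e j (t mod 2 ^ j) < \<omega> (j, t div 2 ^ j))"
  define Q where "Q = (\<lambda>j b. {t. t div 2 ^ j = b \<and> t mod 2 ^ j \<in> R j})"
  have s_in: "s \<omega> t \<longleftrightarrow> e j (t mod 2 ^ j) < \<omega> (j, b)" if "t \<in> Q j b" for \<omega> t j b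
  proof -
    have t: "t mod 2 ^ j \<in> R j" "t div 2 ^ j = b" using that by (auto simp: Q_def)
    have "i = j" if "t mod 2 ^ i \<in> R i" for i
      using disj[of i j t] disj[of j i t] that t(1) by (meson linorder_neqE_nat)
    with t show ?thesis unfolding s_def by blast
  qed
  have s_out: "s (fun_upd \<omega> (j, b) v) t = s \<omega> t" if "t \<notin> Q j b" for \<omega> t j b v
  proof -
    have "(fun_upd \<omega> (j, b) v) (i, t div 2 ^ i) = \<omega> (i, t div 2 ^ i)" if "t mod 2 ^ i \<in> R i" for i
      using that \<open>t \<notin> Q j b\<close> by (auto simp: Q_def)
    then show ?thesis unfolding s_def by metis
  qed
  have Qblock: "b * 2 ^ j \<le> t \<and> t < Suc b * 2 ^ j" if "t \<in> Q j b" for t j b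
  proof -
    have "t div 2 ^ j = b" using that by (simp add: Q_def)
    then have "b * 2 ^ j + t mod 2 ^ j = t" using div_mult_mod_eq[of t "2 ^ j"] by metis
    moreover have "t mod 2 ^ j < 2 ^ j" by simp
    ultimately show ?thesis by (simp; linarith)
  qed
  have count: "card {t \<in> Q j b. e j (t mod 2 ^ j) < v} = v" if "v \<le> D j" for j b v
  proof -
    have "bij_betw (\<lambda>t. e j (t mod 2 ^ j)) {t \<in> Q j b. e j (t mod 2 ^ j) < v} {..<v}"
    proof (rule bij_betw_imageI)
      show "inj_on (\<lambda>t. e j (t mod 2 ^ j)) {t \<in> Q j b. e j (t mod 2 ^ j) < v}"
      proof (rule inj_onI)
        fix t t' assume a: "t \<in> {t \<in> Q j b. e j (t mod 2 ^ j) < v}"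
          "t' \<in> {t \<in> Q j b. e j (t mod 2 ^ j) < v}" "e j (t mod 2 ^ j) = e j (t' mod 2 ^ j)"
        then have "t mod 2 ^ j = t' mod 2 ^ j"
          using e[of j] by (auto simp: bij_betw_def inj_on_def Q_def)
        moreover have "t div 2 ^ j = t' div 2 ^ j" using a by (auto simp: Q_def)
        ultimately show "t = t'" by (metis div_mult_mod_eq)
      qed
      show "(\<lambda>t. e j (t mod 2 ^ j)) ` {t \<in> Q j b. e j (t mod 2 ^ j) < v} = {..<v}"
      proof (intro equalityI subsetI)
        fix i assume i: "i \<in> {..<v}"
        then have "i \<in> e j ` R j" using e[of j] that by (auto simp: bij_betw_def)
        then obtain x where x: "x \<in> R j" "e j x = i" by auto
        then have "x < 2 ^ j" using R by auto
        then have "(b * 2 ^ j + x) div 2 ^ j = b" "(b * 2 ^ j + x) mod 2 ^ j = x" by auto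
        with x i show "i \<in> (\<lambda>t. e j (t mod 2 ^ j)) ` {t \<in> Q j b. e j (t mod 2 ^ j) < v}"
          by (intro image_eqI[of _ _ "b * 2 ^ j + x"]) (auto simp: Q_def)
      qed auto
    qed
    then show ?thesis using bij_betw_same_card by fastforce
  qed
  \<comment> \<open>Once its block is over, a coordinate enters the height only as an added
    summand.\<close>
  have height_split: "height (s \<omega>) r = (\<Sum>t\<in>{..<r} - Q j b. of_bool (s \<omega> t)) + \<omega> (j, b)"
    if "\<omega> (j, b) \<le> D j" "Suc b * 2 ^ j \<le> r" for \<omega> r j b
  proof -
    have sub: "Q j b \<subseteq> {..<r}" using Qblock that(2) by fastforce
    then have fin: "finite (Q j b)" using finite_subset by blast
    have "(\<Sum>t\<in>Q j b. of_bool (s \<omega> t)) = (\<Sum>t\<in>Q j b. of_bool (e j (t mod 2 ^ j) < \<omega> (j, b)) :: nat)"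
      by (intro sum.cong) (simp_all add: s_in)
    also have "\<dots> = card {t \<in> Q j b. e j (t mod 2 ^ j) < \<omega> (j, b)}"
      using fin by (simp add: sum_of_bool_eq Int_def conj_commute)
    also have "\<dots> = \<omega> (j, b)" by (rule count[OF that(1)])
    finally show ?thesis
      unfolding height_def using sum.subset_diff[OF sub, of "\<lambda>t. of_bool (s \<omega> t) :: nat"] by simp
  qed
  show thesis
  proof (rule that[of "4 * H"])
    show "4 * H > 0" using H by simp
  next
    fix n :: nat
    \<comment> \<open>Indices below \<open>n\<close> suffice, since the block used has
      \<open>j < 2 ^ j \<le> n\<close> and \<open>b < r \<le> n\<close>; all other coordinates keep
      the value \<open>undefined\<close>.\<close>
    define \<Omega> where "\<Omega> = PiE ({..<n} \<times> {..<n}) (\<lambda>p. {..D (fst p)})"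
    have fin: "finite \<Omega>" unfolding \<Omega>_def by (intro finite_PiE) auto
    have ne: "\<Omega> \<noteq> {}" unfolding \<Omega>_def by (auto simp: PiE_eq_empty_iff)
    have bound: "real (card {\<omega>\<in>\<Omega>. (\<forall>t<l. s \<omega> t = v t) \<and> height (s \<omega>) r = x})
            \<le> 4 * H / (real (r - l) * h (r - l)) * real (card {\<omega>\<in>\<Omega>. \<forall>t<l. s \<omega> t = v t})"
      if lr: "l < r" "r \<le> n" for l r x v
    proof -
      define k where "k = r - l"
      have k: "k \<ge> 1" "r = l + k" using lr unfolding k_def by auto
      obtain j b where jb: "l \<le> b * 2 ^ j" "Suc b * 2 ^ j \<le> r" "2 ^ j \<le> k" "k < 4 * 2 ^ j"
        using aligned_block[OF k(1), of l] k(2) by metis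
      have "j < 2 ^ j" by simp
      moreover have "2 ^ j \<le> n" using jb(3) lr unfolding k_def by linarith
      ultimately have "j < n" by linarith
      have "Suc b * 1 \<le> Suc b * 2 ^ j" by (intro mult_le_mono2) simp
      from le_trans[OF this jb(2)] have "Suc b \<le> r" by simp
      then have "b < n" using lr by linarith
      let ?A = "{\<omega>\<in>\<Omega>. (\<forall>t<l. s \<omega> t = v t) \<and> height (s \<omega>) r = x}"
      let ?B = "{\<omega>\<in>\<Omega>. \<forall>t<l. s \<omega> t = v t}"
      have mem: "\<omega> (j, b) \<le> D j" if "\<omega> \<in> \<Omega>" for \<omega>
        using that \<open>j < n\<close> \<open>b < n\<close> unfolding \<Omega>_def by (auto simp: PiE_iff)
      \<comment> \<open>Resampling the coordinate \<open>(j, b)\<close> preserves the past, and the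
        old value can be recovered from the height \<open>x\<close> at \<open>r\<close> and the
        unchanged coordinates. So \<open>?A\<close> is at least \<open>D j + 1\<close> times smaller
        than \<open>?B\<close>.\<close>
      have "inj_on (\<lambda>(\<omega>, u). fun_upd \<omega> (j, b) u) (?A \<times> {..D j})"
      proof (rule inj_onI)
        fix p p'
        assume p: "p \<in> ?A \<times> {..D j}" "p' \<in> ?A \<times> {..D j}"
          and eq': "(\<lambda>(\<omega>, u). fun_upd \<omega> (j, b) u) p = (\<lambda>(\<omega>, u). fun_upd \<omega> (j, b) u) p'"
        obtain \<omega> u \<omega>' u' where pp: "p = (\<omega>, u)" "p' = (\<omega>', u')"
          by (cases p, cases p')
        have w: "\<omega> \<in> \<Omega>" "\<omega>' \<in> \<Omega>" "height (s \<omega>) r = height (s \<omega>') r"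
          and eq: "fun_upd \<omega> (j, b) u = fun_upd \<omega>' (j, b) u'"
          using p eq' by (simp_all add: pp)
        have off: "\<omega> p = \<omega>' p" if "p \<noteq> (j, b)" for p
          using fun_cong[OF eq, of p] that by simp
        have "s \<omega> t = s \<omega>' t" if "t \<notin> Q j b" for t
          using s_out[OF that, of \<omega> u] s_out[OF that, of \<omega>' u'] eq by simp
        then have "(\<Sum>t\<in>{..<r} - Q j b. of_bool (s \<omega> t)) = (\<Sum>t\<in>{..<r} - Q j b. of_bool (s \<omega>' t) :: nat)"
          by (intro sum.cong) auto
        then have "\<omega> (j, b) = \<omega>' (j, b)"
          using w(3) height_split[of \<omega>, OF mem[OF w(1)] jb(2)]
            height_split[of \<omega>', OF mem[OF w(2)] jb(2)] by simp
        then have "\<omega> = \<omega>'" using off by (intro ext) metis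
        moreover have "u = u'" using fun_cong[OF eq, of "(j, b)"] by simp
        ultimately show "p = p'" by (simp add: pp)
      qed
      moreover have "(\<lambda>(\<omega>, u). fun_upd \<omega> (j, b) u) ` (?A \<times> {..D j}) \<subseteq> ?B"
      proof (rule image_subsetI)
        fix p assume "p \<in> ?A \<times> {..D j}"
        then obtain \<omega> u where p: "p = (\<omega>, u)"
          and w: "\<omega> \<in> \<Omega>" "u \<in> {..D j}" "\<forall>t<l. s \<omega> t = v t"
          by auto
        have "s (fun_upd \<omega> (j, b) u) t = v t" if "t < l" for t
        proof -
          have "t \<notin> Q j b" using Qblock[of t j b] jb(1) that by linarith
          then show ?thesis using s_out w(3) that by simp
        qed
        moreover have "fun_upd \<omega> (j, b) u \<in> \<Omega>"
          using w \<open>j < n\<close> \<open>b < n\<close> unfolding \<Omega>_def by (auto simp: PiE_iff extensional_def)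
        ultimately show "(\<lambda>(\<omega>, u). fun_upd \<omega> (j, b) u) p \<in> ?B" by (simp add: p)
      qed
      ultimately have "card (?A \<times> {..D j}) \<le> card ?B"
        using fin by (intro card_inj_on_le) auto
      then have "card ?A * (D j + 1) \<le> card ?B" by (simp add: card_cartesian_product)
      then have "real (card ?A) * real (D j + 1) \<le> real (card ?B)"
        using of_nat_mono[of "card ?A * (D j + 1)" "card ?B", where 'a = real] by (simp only: of_nat_mult)
      then have A: "real (card ?A) \<le> real (card ?B) / real (D j + 1)"
        by (simp add: le_divide_eq)
      have hk: "0 < h k" "h k \<le> h (2 ^ j)" using pos dec jb(3) k by auto
      have "real k \<le> real (4 * 2 ^ j)" using jb(4) by (intro of_nat_mono) simp
      then have "real k * h k \<le> 4 * 2 ^ j * h (2 ^ j)"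
        using hk by (intro mult_mono) simp_all
      also have "\<dots> \<le> 4 * H * real (D j + 1)"
      proof -
        have "H * (h (2 ^ j) / H * 2 ^ j) \<le> H * real (D j + 1)"
          using less_imp_le[OF Dgt[of j]] H(1) by (intro mult_left_mono) auto
        then have "2 ^ j * h (2 ^ j) \<le> H * real (D j + 1)" using H(1) by (simp add: mult_ac)
        then have "4 * (2 ^ j * h (2 ^ j)) \<le> 4 * (H * real (D j + 1))" by (intro mult_left_mono) simp_all
        then show ?thesis by (simp only: mult.assoc)
      qed
      finally have "1 / real (D j + 1) \<le> 4 * H / (real k * h k)"
        using hk k by (simp add: divide_le_eq le_divide_eq mult_ac)
      then have "real (card ?B) * (1 / real (D j + 1)) \<le> real (card ?B) * (4 * H / (real k * h k))"
        by (intro mult_left_mono) auto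
      with A show ?thesis unfolding k_def by (simp add: mult.commute)
    qed
    show "\<exists>(\<Omega> :: (nat \<times> nat \<Rightarrow> nat) set) s. unpredictable_family \<Omega> s (4 * H) h n"
      using fin ne bound H(1) pos by (intro exI[of _ \<Omega>] exI[of _ s] unpredictable_family.intro) auto
  qed
qed

section \<open>The hard functions\<close>

lemma DERIV_max_0_square:
  "((\<lambda>x::real. (max 0 x)\<^sup>2) has_real_derivative 2 * max 0 x) (at x)"
proof (cases x "0::real" rule: linorder_cases)
  case less
  have "\<forall>\<^sub>F y in nhds x. (max 0 y)\<^sup>2 = (0::real)"
    by (intro eventually_nhds_in_open[THEN eventually_mono, of "{..<0}"]) (use less in auto)
  then show ?thesis
    using less DERIV_cong_ev[OF refl, of "\<lambda>y. (max 0 y)\<^sup>2" "\<lambda>_. 0" x "2 * max 0 x" 0] by simp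
next
  case greater
  have "\<forall>\<^sub>F y in nhds x. (max 0 y)\<^sup>2 = y\<^sup>2"
    by (intro eventually_nhds_in_open[THEN eventually_mono, of "{0<..}"]) (use greater in auto)
  moreover have "((\<lambda>y. y\<^sup>2) has_real_derivative 2 * x) (at x)"
    by (auto intro!: derivative_eq_intros)
  ultimately show ?thesis
    using greater DERIV_cong_ev[OF refl, of "\<lambda>y. (max 0 y)\<^sup>2" "\<lambda>y. y\<^sup>2" x "2 * max 0 x" "2 * x"] by simp
next
  case equal
  have "((\<lambda>h::real. (max 0 h)\<^sup>2 / h) \<longlongrightarrow> 0) (at 0)"
  proof (rule Lim_null_comparison)
    show "\<forall>\<^sub>F h::real in at 0. norm ((max 0 h)\<^sup>2 / h) \<le> \<bar>h\<bar>"
      by (intro always_eventually) (auto simp: max_def power2_eq_square)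
    show "((\<lambda>h::real. \<bar>h\<bar>) \<longlongrightarrow> 0) (at 0)"
      by (intro tendsto_rabs_zero tendsto_ident_at)
  qed
  then show ?thesis
    using equal by (simp add: DERIV_def)
qed

lemmas DERIV_max_0_square_chain [derivative_intros] =
  DERIV_chain2[OF DERIV_max_0_square]

text \<open>The cross-section of the valley, supported in \<open>[-1, 1]\<close>; the outer square
  makes the derivative Lipschitz across the ends of the support.\<close>

definition bump :: "real \<Rightarrow> real" where
  "bump u = (max 0 (1 - u\<^sup>2))\<^sup>2"

definition bump_deriv :: "real \<Rightarrow> real" where
  "bump_deriv u = - 4 * u * max 0 (1 - u\<^sup>2)"

text \<open>The quadratic spline rising from 0 to 1 on \<open>[0, 1]\<close> whose derivative is a
  tent vanishing at both ends, so that consecutive unit steps join with continuous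
  derivative.\<close>

definition ramp :: "real \<Rightarrow> real" where
  "ramp u = 2 * ((max 0 u)\<^sup>2 - 2 * (max 0 (u - 1/2))\<^sup>2 + (max 0 (u - 1))\<^sup>2)"

definition ramp_deriv :: "real \<Rightarrow> real" where
  "ramp_deriv u = max 0 (min (4 * u) (4 - 4 * u))"

lemma DERIV_bump: "(bump has_real_derivative bump_deriv u) (at u)"
  unfolding bump_def bump_deriv_def
  by (auto intro!: derivative_eq_intros)

lemma DERIV_ramp: "(ramp has_real_derivative ramp_deriv u) (at u)"
  unfolding ramp_def ramp_deriv_def
  by (rule derivative_eq_intros refl)+ (simp add: max_def min_def)

lemma bump_0: "bump 0 = 1"
  by (simp add: bump_def)

lemma bump_outside: "1 \<le> \<bar>u\<bar> \<Longrightarrow> bump u = 0"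
  using abs_square_less_1[of u] unfolding bump_def by (auto simp: max_def)

lemma bump_deriv_outside: "1 \<le> \<bar>u\<bar> \<Longrightarrow> bump_deriv u = 0"
  using abs_square_less_1[of u] unfolding bump_deriv_def by (auto simp: max_def)

lemma bump_deriv_inside: "\<bar>u\<bar> \<le> 1 \<Longrightarrow> bump_deriv u = - 4 * u * (1 - u\<^sup>2)"
  using abs_square_le_1[of u] unfolding bump_deriv_def by (auto simp: max_def)

lemma bump_deriv_sign: "u * bump_deriv u \<le> 0"
proof -
  have "u * bump_deriv u = - (4 * u\<^sup>2 * max 0 (1 - u\<^sup>2))"
    unfolding bump_deriv_def by (simp add: power2_eq_square)
  then show ?thesis by simp
qed

lemma bump_deriv_lipschitz: "\<bar>bump_deriv u - bump_deriv v\<bar> \<le> 8 * \<bar>u - v\<bar>"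
proof -
  \<comment> \<open>Clamping to \<open>[-1, 1]\<close> turns the derivative into a single cubic in a
    1-Lipschitz function; a difference of cubics contains the factor
    \<open>c u - c v\<close>.\<close>
  define c where "c = (\<lambda>u::real. max (-1) (min 1 u))"
  have c: "\<bar>c u\<bar> \<le> 1" "bump_deriv u = - 4 * c u * (1 - (c u)\<^sup>2)" for u
  proof -
    show "\<bar>c u\<bar> \<le> 1" unfolding c_def by auto
    show "bump_deriv u = - 4 * c u * (1 - (c u)\<^sup>2)"
    proof (cases "\<bar>u\<bar> \<le> 1")
      case True
      then have "c u = u" unfolding c_def by auto
      then show ?thesis using bump_deriv_inside[OF True] by simp
    next
      case False
      then have "c u = 1 \<or> c u = -1" unfolding c_def by auto
      then show ?thesis using bump_deriv_outside[of u] False by auto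
    qed
  qed
  let ?m = "(c u)\<^sup>2 + c u * c v + (c v)\<^sup>2"
  have "\<bar>c u * c v\<bar> \<le> 1" using mult_mono[OF c(1)[of u] c(1)[of v]] by (simp add: abs_mult)
  moreover have "(c u)\<^sup>2 \<le> 1" "(c v)\<^sup>2 \<le> 1" using c(1) by (simp_all add: abs_square_le_1)
  moreover have "0 \<le> ?m"
  proof -
    have "4 * ?m = 3 * (c u + c v)\<^sup>2 + (c u - c v)\<^sup>2" by (simp add: power2_eq_square algebra_simps)
    moreover have "0 \<le> 3 * (c u + c v)\<^sup>2 + (c u - c v)\<^sup>2" by simp
    ultimately have "0 \<le> 4 * ?m" by simp
    then show ?thesis by argo
  qed
  ultimately have m: "\<bar>1 - ?m\<bar> \<le> 2" by linarith
  have "bump_deriv u - bump_deriv v = (- 4) * ((c u - c v) * (1 - ?m))"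
    unfolding c(2) by (simp add: power2_eq_square algebra_simps)
  then have "\<bar>bump_deriv u - bump_deriv v\<bar> = 4 * \<bar>c u - c v\<bar> * \<bar>1 - ?m\<bar>"
    by (simp only: abs_mult abs_neg_numeral mult.assoc)
  also have "\<dots> \<le> 4 * \<bar>u - v\<bar> * 2"
    using m by (intro mult_mono) (auto simp: c_def max_def min_def)
  finally show ?thesis by simp
qed

lemma bump_deriv_bound: "\<bar>bump_deriv u\<bar> \<le> 4"
proof (cases "\<bar>u\<bar> \<le> 1")
  case True
  then have "u\<^sup>2 \<le> 1" by (simp add: abs_square_le_1)
  then have "\<bar>u\<bar> * \<bar>1 - u\<^sup>2\<bar> \<le> 1 * 1"
    using True by (intro mult_mono) auto
  then show ?thesis by (simp add: bump_deriv_inside[OF True] abs_mult)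
qed (use bump_deriv_outside[of u] in simp)

lemma bump_lipschitz: "\<bar>bump u - bump v\<bar> \<le> 4 * \<bar>u - v\<bar>"
  using field_differentiable_bound[of UNIV bump bump_deriv 4 u v] DERIV_bump bump_deriv_bound
  by simp

text \<open>With \<open>bump u = p\<^sup>2\<close> the derivative is \<open>- 4 * u * p\<close>, and
  in between both factors are bounded away from 0. In \<open>landscape_stationary\<close>,
  \<open>3 / 20\<close> arises as a steepness of 3 over \<open>n \<ge> 20\<close>, and
  \<open>11 * bump u\<close> has to be below 1 or above 9.\<close>

lemma bump_flat:
  assumes "\<bar>bump_deriv u\<bar> \<le> 3 / 20"
  shows "bump u < 1 / 12 \<or> bump u > 11 / 12"
proof (rule ccontr)
  assume a: "\<not> ?thesis"
  define p where "p = max 0 (1 - u\<^sup>2)"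
  have p: "bump u = p\<^sup>2" "bump_deriv u = - 4 * u * p" "p \<ge> 0"
    by (simp_all add: p_def bump_def bump_deriv_def)
  have p2: "1 / 12 \<le> p\<^sup>2" "p\<^sup>2 \<le> 11 / 12" using a p(1) by auto
  have "p \<le> 0.96" using p2(2) by (intro power2_le_imp_le[of p "0.96"]) (auto simp: power2_eq_square)
  moreover have "p > 0" using p2 p(3) by (cases "p = 0") auto
  then have "u\<^sup>2 = 1 - p" by (auto simp: p_def max_def split: if_splits)
  ultimately have "0.04 * (1 / 12) \<le> u\<^sup>2 * p\<^sup>2"
    using p2(1) by (intro mult_mono) auto
  moreover have "(bump_deriv u)\<^sup>2 \<le> (3 / 20)\<^sup>2"
    using power_mono[OF assms, of 2] by simp
  moreover have "(bump_deriv u)\<^sup>2 = 16 * (u\<^sup>2 * p\<^sup>2)"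
    unfolding p(2) by (simp add: power_mult_distrib)
  ultimately show False by (simp add: power2_eq_square)
qed

lemma ramp_le_0: "u \<le> 0 \<Longrightarrow> ramp u = 0"
  by (simp add: ramp_def)

lemma ramp_ge_1: "1 \<le> u \<Longrightarrow> ramp u = 1"
  by (simp add: ramp_def power2_eq_square algebra_simps)

lemma ramp_bounds: "0 \<le> u \<Longrightarrow> u \<le> 1 \<Longrightarrow> 0 \<le> ramp u \<and> ramp u \<le> 1"
proof -
  assume u: "0 \<le> u" "u \<le> 1"
  show ?thesis
  proof (cases "u \<le> 1/2")
    case True
    then have "ramp u = 2 * u\<^sup>2" using u by (simp add: ramp_def)
    moreover have "u\<^sup>2 \<le> (1/2)\<^sup>2" using True u by (intro power_mono) auto
    ultimately show ?thesis by (simp add: power2_eq_square)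
  next
    case False
    then have "ramp u = 1 - 2 * (1 - u)\<^sup>2" using u by (simp add: ramp_def power2_eq_square algebra_simps)
    moreover have "(1 - u)\<^sup>2 \<le> (1/2)\<^sup>2" using False u by (intro power_mono) auto
    ultimately show ?thesis by (simp add: power2_eq_square)
  qed
qed

section \<open>The smoothed lattice path\<close>

text \<open>The path with smoothed corners, as a function of the vertical coordinate in units of the
  mesh. The sum includes \<open>n\<close> so that the top edge \<open>y = n\<close> also belongs to
  a row.\<close>

definition curve :: "nat \<Rightarrow> (nat \<Rightarrow> bool) \<Rightarrow> real \<Rightarrow> real" where
  "curve n s y = (\<Sum>t\<le>n. of_bool (s t) * ramp (y - real t))"

definition slope :: "nat \<Rightarrow> (nat \<Rightarrow> bool) \<Rightarrow> real \<Rightarrow> real" where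
  "slope n s y = (\<Sum>t\<le>n. of_bool (s t) * ramp_deriv (y - real t))"

lemma DERIV_curve: "(curve n s has_real_derivative slope n s y) (at y)"
  unfolding curve_def slope_def
  by (auto intro!: derivative_eq_intros DERIV_chain2[OF DERIV_ramp] sum.cong)

lemma sum_split_row:
  fixes g :: "nat \<Rightarrow> real"
  assumes "r \<le> n"
  shows "(\<Sum>t\<le>n. g t) = (\<Sum>t<r. g t) + g r + (\<Sum>t\<in>{r<..n}. g t)"
proof -
  have "{..n} = insert r ({..<r} \<union> {r<..n})" using assms by auto
  then have "(\<Sum>t\<le>n. g t) = g r + (\<Sum>t\<in>{..<r} \<union> {r<..n}. g t)" by simp
  also have "(\<Sum>t\<in>{..<r} \<union> {r<..n}. g t) = (\<Sum>t<r. g t) + (\<Sum>t\<in>{r<..n}. g t)"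
    by (intro sum.union_disjoint) auto
  finally show ?thesis by simp
qed

lemma curve_row:
  assumes "r \<le> n" "real r \<le> y" "y \<le> real r + 1"
  shows "curve n s y = real (height s r) + of_bool (s r) * ramp (y - real r)"
proof -
  have "ramp (y - real t) = 1" if "t < r" for t
    using that assms(2) by (intro ramp_ge_1) linarith
  then have "(\<Sum>t<r. of_bool (s t) * ramp (y - real t)) = (\<Sum>t<r. of_bool (s t))"
    by (intro sum.cong) auto
  moreover have "(\<Sum>t\<in>{r<..n}. of_bool (s t) * ramp (y - real t)) = 0"
    using assms by (intro sum.neutral) (auto intro!: ramp_le_0)
  ultimately show ?thesis
    unfolding curve_def sum_split_row[OF assms(1)] height_def by simp
qed

lemma slope_row:
  assumes "r \<le> n" "real r \<le> y" "y \<le> real r + 1"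
  shows "slope n s y = of_bool (s r) * ramp_deriv (y - real r)"
proof -
  have "(\<Sum>t<r. of_bool (s t) * ramp_deriv (y - real t)) = 0"
    using assms by (intro sum.neutral) (auto simp: ramp_deriv_def)
  moreover have "(\<Sum>t\<in>{r<..n}. of_bool (s t) * ramp_deriv (y - real t)) = 0"
    using assms by (intro sum.neutral) (auto simp: ramp_deriv_def)
  ultimately show ?thesis
    unfolding slope_def sum_split_row[OF assms(1)] by simp
qed

lemma row_exists:
  assumes "0 \<le> y" "y \<le> real n"
  shows "nat \<lfloor>y\<rfloor> \<le> n" "real (nat \<lfloor>y\<rfloor>) \<le> y" "y < real (nat \<lfloor>y\<rfloor>) + 1"
  using assms by linarith+

lemma slope_bounds:
  assumes "0 \<le> y" "y \<le> real n"
  shows "0 \<le> slope n s y \<and> slope n s y \<le> 2"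
  using slope_row[OF row_exists(1,2)[OF assms] less_imp_le[OF row_exists(3)[OF assms]]]
  by (auto simp: ramp_deriv_def max_def min_def)

lemma slope_lipschitz_aux:
  assumes "0 \<le> y" "y \<le> z" "z \<le> real n"
  shows "\<bar>slope n s y - slope n s z\<bar> \<le> 4 * \<bar>y - z\<bar>"
proof -
  define r q where "r = nat \<lfloor>y\<rfloor>" and "q = nat \<lfloor>z\<rfloor>"
  have r: "r \<le> n" "real r \<le> y" "y < real r + 1" using row_exists[of y n] assms by (auto simp: r_def)
  have q: "q \<le> n" "real q \<le> z" "z < real q + 1" using row_exists[of z n] assms by (auto simp: q_def)
  have eq: "slope n s y = of_bool (s r) * ramp_deriv (y - real r)"
    "slope n s z = of_bool (s q) * ramp_deriv (z - real q)"
    using slope_row r q by auto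
  have "r \<le> q" unfolding r_def q_def using assms by (intro nat_mono floor_mono)
  then consider "r = q" | "real r + 1 \<le> real q" by linarith
  then show ?thesis
  proof cases
    case 1
    have "\<bar>ramp_deriv a - ramp_deriv b\<bar> \<le> 4 * \<bar>a - b\<bar>" for a b
      unfolding ramp_deriv_def max_def min_def by (smt (verit))
    from this[of "y - real q" "z - real q"] 1 show ?thesis unfolding eq by auto
  next
    \<comment> \<open>The slope vanishes at the row boundaries between \<open>y\<close> and
      \<open>z\<close>, so each value is at most 4 times the distance to such a boundary.\<close>
    case 2
    have "0 \<le> slope n s y" "slope n s y \<le> 4 * (real r + 1 - y)"
      unfolding eq using r by (auto simp: ramp_deriv_def max_def min_def)
    moreover have "0 \<le> slope n s z" "slope n s z \<le> 4 * (z - real q)"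
      unfolding eq using q by (auto simp: ramp_deriv_def max_def min_def)
    ultimately show ?thesis using 2 r q by (smt (verit))
  qed
qed

lemma slope_lipschitz:
  assumes "y \<in> {0..real n}" "z \<in> {0..real n}"
  shows "\<bar>slope n s y - slope n s z\<bar> \<le> 4 * \<bar>y - z\<bar>"
  using slope_lipschitz_aux[of y z n s] slope_lipschitz_aux[of z y n s] assms by (cases "y \<le> z") auto

lemma curve_lipschitz:
  assumes "y \<in> {0..real n}" "z \<in> {0..real n}"
  shows "\<bar>curve n s y - curve n s z\<bar> \<le> 2 * \<bar>y - z\<bar>"
  using field_differentiable_bound[of "{0..real n}" "curve n s" "slope n s" 2 y z]
    DERIV_curve[THEN has_field_derivative_at_within] slope_bounds[of _ n s] assms
  by simp

lemma height_le: "height s r \<le> r"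
proof -
  have "height s r \<le> (\<Sum>t<r. 1)" unfolding height_def by (intro sum_mono) simp
  then show ?thesis by simp
qed

lemma curve_le:
  assumes "0 \<le> y" "y \<le> real n"
  shows "0 \<le> curve n s y \<and> curve n s y \<le> real n"
proof -
  let ?r = "nat \<lfloor>y\<rfloor>"
  have r: "?r \<le> n" "real ?r \<le> y" "y < real ?r + 1" using row_exists[OF assms] by auto
  have eq: "curve n s y = real (height s ?r) + of_bool (s ?r) * ramp (y - real ?r)"
    using curve_row r by simp
  show ?thesis
  proof (cases "?r = n")
    case True
    then have "y - real ?r = 0" using r assms by simp
    then show ?thesis using eq height_le[of s n] True by (simp add: ramp_le_0)
  next
    case False
    then have "real ?r + 1 \<le> real n" using r(1) by linarith
    moreover have "real (height s ?r) \<le> real ?r" using height_le by simp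
    moreover have "0 \<le> ramp (y - real ?r) \<and> ramp (y - real ?r) \<le> 1"
      using r by (intro ramp_bounds) linarith+
    then have "0 \<le> of_bool (s ?r) * ramp (y - real ?r) \<and> of_bool (s ?r) * ramp (y - real ?r) \<le> 1"
      by simp
    ultimately show ?thesis unfolding eq using of_nat_0_le_iff[of "height s ?r"] by linarith
  qed
qed

section \<open>The landscape and its smoothness\<close>

definition offset :: "nat \<Rightarrow> (nat \<Rightarrow> bool) \<Rightarrow> real \<times> real \<Rightarrow> real" where
  "offset n s z = real n * fst z - curve n s (real n * snd z)"

text \<open>
  A tilted plane draining to the origin, with a valley along the curve that starts there. The valley
  deepens faster (\<open>11\<close>) than the plane rises, so its floor descends all the way to the edge
  \<open>y = 1\<close>.
\<close>

definition landscape :: "real \<Rightarrow> nat \<Rightarrow> (nat \<Rightarrow> bool) \<Rightarrow> real \<times> real \<Rightarrow> real" where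
  "landscape \<epsilon> n s z = \<epsilon> * (2 * fst z + 2 * snd z - (1 + 11 * snd z) * bump (offset n s z))"

text \<open>The contribution of the chain rule through \<open>offset\<close>, shared by both
  components of the gradient; its size is of order \<open>n\<close> and its Lipschitz constant of
  order \<open>n\<^sup>2\<close>.\<close>

definition steepness :: "nat \<Rightarrow> (nat \<Rightarrow> bool) \<Rightarrow> real \<times> real \<Rightarrow> real" where
  "steepness n s z = (1 + 11 * snd z) * (real n * bump_deriv (offset n s z))"

definition landscape_grad :: "real \<Rightarrow> nat \<Rightarrow> (nat \<Rightarrow> bool) \<Rightarrow> real \<times> real \<Rightarrow> real \<times> real" where
  "landscape_grad \<epsilon> n s z =
     (\<epsilon> * (2 - steepness n s z),
      \<epsilon> * (2 - 11 * bump (offset n s z) + steepness n s z * slope n s (real n * snd z)))"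

lemma landscape_has_derivative:
  "(landscape \<epsilon> n s has_derivative (\<lambda>v. landscape_grad \<epsilon> n s z \<bullet> v)) (at z within A)"
proof -
  have "((\<lambda>z. real n * snd z) has_derivative (\<lambda>v. real n * snd v)) (at z within A)"
    by (auto intro!: derivative_eq_intros)
  from DERIV_compose_FDERIV[OF DERIV_curve[of n s] this]
  have "(offset n s has_derivative
      (\<lambda>v. real n * fst v - real n * snd v * slope n s (real n * snd z))) (at z within A)"
    unfolding offset_def by (auto intro!: derivative_eq_intros)
  note D = DERIV_compose_FDERIV[OF DERIV_bump this]
  show ?thesis
    unfolding landscape_def
    by (rule derivative_eq_intros D refl)+
      (auto simp: fun_eq_iff landscape_grad_def inner_prod_def steepness_def algebra_simps)
qed

lemma unit_square_iff: "z \<in> unit_square \<longleftrightarrow> fst z \<in> {0..1} \<and> snd z \<in> {0..1}"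
  by (cases z) (simp add: unit_square_def)

lemma abs_diff_le_norm:
  fixes z w :: "real \<times> real"
  shows "\<bar>fst z - fst w\<bar> \<le> norm (z - w)" "\<bar>snd z - snd w\<bar> \<le> norm (z - w)"
  using norm_fst_le[of "fst (z - w)" "snd (z - w)"] norm_snd_le[of "snd (z - w)" "fst (z - w)"]
  by (simp_all del: fst_diff snd_diff add: fst_diff[symmetric] snd_diff[symmetric])

lemma offset_lipschitz:
  assumes "z \<in> unit_square" "w \<in> unit_square"
  shows "\<bar>offset n s z - offset n s w\<bar> \<le> 3 * real n * norm (z - w)"
proof -
  let ?d = "norm (z - w)"
  have "\<bar>offset n s z - offset n s w\<bar> \<le> \<bar>real n * fst z - real n * fst w\<bar>
      + \<bar>curve n s (real n * snd z) - curve n s (real n * snd w)\<bar>"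
    unfolding offset_def by linarith
  also have "\<dots> \<le> \<bar>real n * fst z - real n * fst w\<bar> + 2 * \<bar>real n * snd z - real n * snd w\<bar>"
    using assms by (intro add_left_mono curve_lipschitz) (auto simp: unit_square_iff mult_left_le)
  also have "\<dots> = real n * \<bar>fst z - fst w\<bar> + 2 * (real n * \<bar>snd z - snd w\<bar>)"
    by (simp add: abs_mult flip: right_diff_distrib)
  also have "\<dots> \<le> real n * ?d + 2 * (real n * ?d)"
    using abs_diff_le_norm[of z w] by (intro add_mono mult_left_mono) auto
  finally show ?thesis by simp
qed

lemma mult_diff_bound:
  fixes a b c d :: real
  assumes "\<bar>a - b\<bar> \<le> p" "\<bar>c\<bar> \<le> C" "\<bar>b\<bar> \<le> B" "\<bar>c - d\<bar> \<le> q"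
  shows "\<bar>a * c - b * d\<bar> \<le> p * C + B * q"
proof -
  have "a * c - b * d = (a - b) * c + b * (c - d)" by (simp add: algebra_simps)
  then have "\<bar>a * c - b * d\<bar> \<le> \<bar>a - b\<bar> * \<bar>c\<bar> + \<bar>b\<bar> * \<bar>c - d\<bar>"
    by (metis abs_mult abs_triangle_ineq)
  also have "\<dots> \<le> p * C + B * q"
    using assms by (intro add_mono mult_mono) auto
  finally show ?thesis .
qed

lemma steepness_bound:
  assumes "z \<in> unit_square"
  shows "\<bar>steepness n s z\<bar> \<le> 48 * real n"
proof -
  have "\<bar>1 + 11 * snd z\<bar> * (real n * \<bar>bump_deriv (offset n s z)\<bar>) \<le> 12 * (real n * 4)"
    using assms bump_deriv_bound by (intro mult_mono mult_left_mono) (auto simp: unit_square_iff)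
  then show ?thesis by (simp add: steepness_def abs_mult)
qed

lemma steepness_lipschitz:
  assumes "z \<in> unit_square" "w \<in> unit_square" "n \<ge> 1"
  shows "\<bar>steepness n s z - steepness n s w\<bar> \<le> 332 * (real n)\<^sup>2 * norm (z - w)"
proof -
  let ?b = "\<lambda>z. real n * bump_deriv (offset n s z)"
  have "\<bar>?b z - ?b w\<bar> = real n * \<bar>bump_deriv (offset n s z) - bump_deriv (offset n s w)\<bar>"
    by (simp add: abs_mult flip: right_diff_distrib)
  also have "\<dots> \<le> real n * (8 * (3 * real n * norm (z - w)))"
    using bump_deriv_lipschitz[of "offset n s z" "offset n s w"] offset_lipschitz[OF assms(1,2), of n s]
    by (intro mult_left_mono) auto
  finally have 1: "\<bar>?b z - ?b w\<bar> \<le> 24 * (real n)\<^sup>2 * norm (z - w)"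
    by (simp add: power2_eq_square)
  have 2: "\<bar>?b z\<bar> \<le> real n * 4"
    unfolding abs_mult using bump_deriv_bound by (auto intro: mult_left_mono)
  have 3: "\<bar>(1 + 11 * snd z) - (1 + 11 * snd w)\<bar> \<le> 11 * norm (z - w)"
    using abs_diff_le_norm(2)[of z w] by linarith
  have 4: "\<bar>1 + 11 * snd w\<bar> \<le> 12" using assms by (auto simp: unit_square_iff)
  have "\<bar>steepness n s z - steepness n s w\<bar> \<le> 11 * norm (z - w) * (real n * 4) + 12 * (24 * (real n)\<^sup>2 * norm (z - w))"
    unfolding steepness_def by (rule mult_diff_bound[OF 3 2 4 1])
  also have "\<dots> \<le> 332 * (real n)\<^sup>2 * norm (z - w)"
  proof -
    have "real n * norm (z - w) \<le> (real n)\<^sup>2 * norm (z - w)"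
      using assms(3) by (intro mult_right_mono) (auto simp: power2_eq_square)
    then show ?thesis by (simp add: algebra_simps)
  qed
  finally show ?thesis .
qed

lemma landscape_grad_lipschitz:
  assumes "z \<in> unit_square" "w \<in> unit_square" "n \<ge> 1" "\<epsilon> > 0" "1600 * \<epsilon> * (real n)\<^sup>2 \<le> 1"
  shows "norm (landscape_grad \<epsilon> n s z - landscape_grad \<epsilon> n s w) \<le> norm (z - w)"
proof -
  define \<delta> where "\<delta> = norm (z - w)"
  define N where "N = (real n)\<^sup>2"
  have N: "real n \<le> N" "0 \<le> \<delta>" using assms(3) by (auto simp: N_def power2_eq_square \<delta>_def)
  have nd: "real n * \<delta> \<le> N * \<delta>" using N by (intro mult_right_mono) auto
  let ?q = "steepness n s" and ?g = "\<lambda>z. slope n s (real n * snd z)" and ?u = "offset n s"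
  have q: "\<bar>?q z - ?q w\<bar> \<le> 332 * N * \<delta>"
    using steepness_lipschitz[OF assms(1,2,3)] by (simp add: N_def \<delta>_def)
  have dom: "real n * snd z \<in> {0..real n}" "real n * snd w \<in> {0..real n}"
    using assms by (auto simp: unit_square_iff mult_left_le)
  have "\<bar>?g z - ?g w\<bar> \<le> 4 * \<bar>real n * snd z - real n * snd w\<bar>"
    by (rule slope_lipschitz[OF dom])
  also have "\<dots> = 4 * (real n * \<bar>snd z - snd w\<bar>)"
    by (simp add: abs_mult flip: right_diff_distrib)
  also have "\<dots> \<le> 4 * (real n * \<delta>)"
    using abs_diff_le_norm(2)[of z w] unfolding \<delta>_def
    by (intro mult_left_mono) auto
  finally have g: "\<bar>?g z - ?g w\<bar> \<le> 4 * (real n * \<delta>)" .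
  have gb: "\<bar>?g z\<bar> \<le> 2" using slope_bounds[of "real n * snd z" n s] dom by auto
  have "\<bar>?q z * ?g z - ?q w * ?g w\<bar> \<le> 332 * N * \<delta> * 2 + 48 * real n * (4 * (real n * \<delta>))"
    by (rule mult_diff_bound[OF q gb steepness_bound[OF assms(2)] g])
  also have "\<dots> = 856 * (N * \<delta>)" by (simp add: N_def power2_eq_square)
  finally have qg: "\<bar>?q z * ?g z - ?q w * ?g w\<bar> \<le> 856 * (N * \<delta>)" .
  have b: "\<bar>bump (?u z) - bump (?u w)\<bar> \<le> 12 * (N * \<delta>)"
  proof -
    have "\<bar>bump (?u z) - bump (?u w)\<bar> \<le> 4 * \<bar>?u z - ?u w\<bar>" by (rule bump_lipschitz)
    also have "\<dots> \<le> 4 * (3 * real n * \<delta>)"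
      using offset_lipschitz[OF assms(1,2), of n s] unfolding \<delta>_def by (intro mult_left_mono) auto
    also have "\<dots> \<le> 12 * (N * \<delta>)" using nd by simp
    finally show ?thesis .
  qed
  have "norm (landscape_grad \<epsilon> n s z - landscape_grad \<epsilon> n s w)
     \<le> \<bar>\<epsilon> * (2 - ?q z) - \<epsilon> * (2 - ?q w)\<bar>
        + \<bar>\<epsilon> * (2 - 11 * bump (?u z) + ?q z * ?g z) - \<epsilon> * (2 - 11 * bump (?u w) + ?q w * ?g w)\<bar>"
    using norm_Pair_le[of "fst (landscape_grad \<epsilon> n s z - landscape_grad \<epsilon> n s w)"
        "snd (landscape_grad \<epsilon> n s z - landscape_grad \<epsilon> n s w)"]
    by (simp add: landscape_grad_def)
  also have "\<dots> = \<epsilon> * (\<bar>?q z - ?q w\<bar>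
        + \<bar>(?q z * ?g z - ?q w * ?g w) - 11 * (bump (?u z) - bump (?u w))\<bar>)"
  proof -
    have "\<epsilon> * (2 - ?q z) - \<epsilon> * (2 - ?q w) = \<epsilon> * (?q w - ?q z)"
      "\<epsilon> * (2 - 11 * bump (?u z) + ?q z * ?g z) - \<epsilon> * (2 - 11 * bump (?u w) + ?q w * ?g w)
        = \<epsilon> * ((?q z * ?g z - ?q w * ?g w) - 11 * (bump (?u z) - bump (?u w)))"
      by (simp_all add: right_diff_distrib distrib_left)
    then show ?thesis
      using assms(4) by (simp only: abs_mult abs_of_pos distrib_left abs_minus_commute[of "?q w"])
  qed
  \<comment> \<open>The constants add up to \<open>332 + 856 + 11 * 12 = 1320\<close>;
    \<open>1600 = 40\<^sup>2\<close> is a convenient square above it.\<close>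
  also have "\<dots> \<le> \<epsilon> * (1600 * (N * \<delta>))"
  proof (rule mult_left_mono)
    have "\<bar>(?q z * ?g z - ?q w * ?g w) - 11 * (bump (?u z) - bump (?u w))\<bar>
        \<le> \<bar>?q z * ?g z - ?q w * ?g w\<bar> + 11 * \<bar>bump (?u z) - bump (?u w)\<bar>"
      by (rule order_trans[OF abs_triangle_ineq4]) (simp only: abs_mult abs_numeral order_refl)
    moreover have "0 \<le> N * \<delta>" using N by simp
    ultimately show "\<bar>?q z - ?q w\<bar> + \<bar>(?q z * ?g z - ?q w * ?g w) - 11 * (bump (?u z) - bump (?u w))\<bar>
        \<le> 1600 * (N * \<delta>)"
      using q qg b by simp
  qed (use assms(4) in simp)
  also have "\<dots> = (1600 * \<epsilon> * N) * \<delta>" by simp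
  also have "\<dots> \<le> 1 * \<delta>"
    using assms(5) N by (intro mult_right_mono) (auto simp: N_def)
  finally show ?thesis by (simp add: \<delta>_def)
qed

lemma smooth_landscape:
  assumes "n \<ge> 1" "\<epsilon> > 0" "1600 * \<epsilon> * (real n)\<^sup>2 \<le> 1"
  shows "smooth (landscape \<epsilon> n s)"
  unfolding smooth_def
  using landscape_has_derivative landscape_grad_lipschitz[OF _ _ assms] by blast

section \<open>Location of the stationary points\<close>

text \<open>To first order, a short step along \<open>v\<close> lowers \<open>f\<close> at a rate
  strictly above \<open>\<epsilon>\<close>. Edge points are covered as long as \<open>v\<close>
  points into the square.\<close>

lemma not_stationary_if_descent:
  assumes der: "(f has_derivative (\<lambda>v. g \<bullet> v)) (at x within unit_square)"
    and v: "norm v = 1" and \<delta>: "\<delta> > 0" "\<And>t. 0 \<le> t \<Longrightarrow> t \<le> \<delta> \<Longrightarrow> x + t *\<^sub>R v \<in> unit_square"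
    and descent: "g \<bullet> v < - \<epsilon>"
  shows "\<not> stationary_point \<epsilon> f x"
proof
  assume st: "stationary_point \<epsilon> f x"
  define m where "m = - (g \<bullet> v)"
  \<comment> \<open>The gap \<open>m - \<epsilon> = 4 * e\<close> pays once for
    \<open>\<epsilon>' = \<epsilon> + e\<close> and once for the linearization error, with
    slack.\<close>
  define e where "e = (m - \<epsilon>) / 4"
  have e: "e > 0" using descent by (simp add: e_def m_def)
  obtain d where d: "d > 0" "\<And>y. y \<in> unit_square \<Longrightarrow> norm (y - x) < d \<Longrightarrow>
      \<bar>f y - f x - g \<bullet> (y - x)\<bar> \<le> e * norm (y - x)"
    using der e unfolding has_derivative_within_alt by (auto simp: real_norm_def)
  have "\<epsilon> < \<epsilon> + e" using e by simp
  then obtain N where N: "openin (top_of_set unit_square) N" "x \<in> N"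
      "\<And>y. y \<in> N \<Longrightarrow> f x \<le> f y + (\<epsilon> + e) * norm (x - y)"
    using st unfolding stationary_point_def by blast
  obtain r where r: "r > 0" "ball x r \<inter> unit_square \<subseteq> N"
    using N(1,2) unfolding openin_contains_ball by blast
  define t where "t = min \<delta> (min (d / 2) (r / 2))"
  have t: "t > 0" "t \<le> \<delta>" "t < d" "t < r" using \<delta>(1) d(1) r(1) by (auto simp: t_def)
  let ?y = "x + t *\<^sub>R v"
  have y: "?y \<in> unit_square" "norm (?y - x) = t" "norm (x - ?y) = t"
    using \<delta>(2)[of t] t v by auto
  then have "?y \<in> N" using r(2) t by (auto simp: dist_norm)
  then have "f x \<le> f ?y + (\<epsilon> + e) * t" using N(3)[of ?y] y by simp
  moreover have "\<bar>f ?y - f x - g \<bullet> (?y - x)\<bar> \<le> e * t"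
    using d(2)[of ?y] y t by simp
  then have "f ?y - f x \<le> - (m * t) + e * t" by (simp add: m_def abs_le_iff algebra_simps)
  ultimately have "0 \<le> (\<epsilon> + e - m + e) * t" by (simp add: algebra_simps)
  moreover have "\<epsilon> + e - m + e < 0" using e unfolding e_def by argo
  ultimately show False using t(1) by (simp add: zero_le_mult_iff)
qed

text \<open>Horizontal moves confine the steepness to \<open>[0, 3]\<close>, so by
  \<open>bump_flat\<close> the point is on the valley floor or essentially outside the valley.
  Outside, the plane leads to the origin, which lies on the floor; on the floor, going up is descent
  until the top edge.\<close>

lemma landscape_stationary:
  assumes st: "stationary_point \<epsilon> (landscape \<epsilon> n s) z" and "\<epsilon> > 0" "n \<ge> 20"
  shows "snd z = 1 \<and> bump (offset n s z) > 0"
proof (rule ccontr)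
  assume neg: "\<not> ?thesis"
  have z: "0 \<le> fst z" "fst z \<le> 1" "0 \<le> snd z" "snd z \<le> 1"
    using st by (auto simp: stationary_point_def unit_square_iff)
  define q where "q = steepness n s z"
  define p where "p = bump (offset n s z)"
  define G where "G = slope n s (real n * snd z)"
  have G: "0 \<le> G" "G \<le> 2" using slope_bounds[of "real n * snd z" n s] z by (auto simp: G_def mult_left_le)
  have c: "0 \<le> curve n s (real n * snd z)" "curve n s (real n * snd z) \<le> real n"
    using curve_le[of "real n * snd z" n s] z by (auto simp: mult_left_le)
  have no: False
    if "norm v = 1" "\<delta> > 0" "\<And>t. 0 \<le> t \<Longrightarrow> t \<le> \<delta> \<Longrightarrow> z + t *\<^sub>R v \<in> unit_square"
      "landscape_grad \<epsilon> n s z \<bullet> v < - \<epsilon>" for v \<delta>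
    using not_stationary_if_descent[OF landscape_has_derivative that] st by blast
  have grad: "landscape_grad \<epsilon> n s z = (\<epsilon> * (2 - q), \<epsilon> * (2 - 11 * p + q * G))"
    by (simp add: landscape_grad_def q_def p_def G_def)
  \<comment> \<open>Each axis direction bounds one partial derivative from one side, wherever the
    square allows that move.\<close>
  have left: "q \<ge> 1" if "fst z > 0"
  proof (rule ccontr)
    assume "\<not> q \<ge> 1"
    then have "\<epsilon> * 1 < \<epsilon> * (2 - q)" using assms(2) by (intro mult_strict_left_mono) auto
    then show False
      using that z by (intro no[of "(-1, 0)" "fst z"]) (auto simp: grad unit_square_iff)
  qed
  have right: "q \<le> 3" if "fst z < 1"
  proof (rule ccontr)
    assume "\<not> q \<le> 3"
    then have "\<epsilon> * (2 - q) < \<epsilon> * (-1)" using assms(2) by (intro mult_strict_left_mono) auto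
    then show False
      using that z by (intro no[of "(1, 0)" "1 - fst z"]) (auto simp: grad unit_square_iff)
  qed
  have down: "2 - 11 * p + q * G \<le> 1" if "snd z > 0"
  proof (rule ccontr)
    assume "\<not> ?thesis"
    then have "\<epsilon> * 1 < \<epsilon> * (2 - 11 * p + q * G)" using assms(2) by (intro mult_strict_left_mono) auto
    then show False
      using that z by (intro no[of "(0, -1)" "snd z"]) (auto simp: grad unit_square_iff)
  qed
  have up: "2 - 11 * p + q * G \<ge> -1" if "snd z < 1"
  proof (rule ccontr)
    assume "\<not> ?thesis"
    then have "\<epsilon> * (2 - 11 * p + q * G) < \<epsilon> * (-1)" using assms(2) by (intro mult_strict_left_mono) auto
    then show False
      using that z by (intro no[of "(0, 1)" "1 - snd z"]) (auto simp: grad unit_square_iff)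
  qed
  have neg_offset: "offset n s z < 0" if "q > 0"
  proof -
    have "bump_deriv (offset n s z) > 0"
      using that z(3) unfolding q_def steepness_def by (auto simp: zero_less_mult_iff)
    then show ?thesis using bump_deriv_sign[of "offset n s z"]
      by (smt (verit) bump_deriv_def mult_nonneg_nonneg mult_minus_left max.cobounded1)
  qed
  \<comment> \<open>No move to the left exists on the left edge, but the curve is never left of it,
    which fixes the sign of the steepness; \<open>q3\<close> treats the right edge likewise.\<close>
  have q0: "q \<ge> 0"
  proof (cases "fst z > 0")
    case True
    then show ?thesis using left by simp
  next
    case False
    then have "offset n s z \<le> 0" using c z by (simp add: offset_def)
    then have "bump_deriv (offset n s z) \<ge> 0"
      unfolding bump_deriv_def by (simp add: mult_nonneg_nonneg mult_nonpos_nonneg)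
    then show ?thesis using z unfolding q_def steepness_def by simp
  qed
  have q3: "q \<le> 3"
  proof (cases "fst z < 1")
    case False
    then have "fst z = 1" using z by simp
    then have "offset n s z \<ge> 0" using c by (simp add: offset_def)
    then show ?thesis using neg_offset by linarith
  qed (rule right)
  have "real n * \<bar>bump_deriv (offset n s z)\<bar> \<le> \<bar>1 + 11 * snd z\<bar> * (real n * \<bar>bump_deriv (offset n s z)\<bar>)"
    using z mult_right_mono[of 1 "\<bar>1 + 11 * snd z\<bar>" "real n * \<bar>bump_deriv (offset n s z)\<bar>"] by simp
  also have "\<dots> = \<bar>q\<bar>" by (simp add: q_def steepness_def abs_mult)
  finally have "real n * \<bar>bump_deriv (offset n s z)\<bar> \<le> 3" using q0 q3 by simp
  moreover have "20 * \<bar>bump_deriv (offset n s z)\<bar> \<le> real n * \<bar>bump_deriv (offset n s z)\<bar>"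
    using assms(3) by (intro mult_right_mono) auto
  ultimately have "\<bar>bump_deriv (offset n s z)\<bar> \<le> 3 / 20" by simp
  then consider "p < 1 / 12" | "p > 11 / 12" using bump_flat unfolding p_def by blast
  then show False
  proof cases
    \<comment> \<open>Here the vertical derivative exceeds \<open>\<epsilon>\<close>, which forces
      the bottom edge. The curve starts at 0 there, so a positive \<open>fst z\<close> has positive
      offset and contradicts \<open>left\<close>, while at the origin the bump is 1.\<close>
    case 1
    have "q * G \<ge> 0" using q0 G by simp
    then have y0: "snd z = 0" using 1 down z by fastforce
    then have off: "offset n s z = real n * fst z"
      using curve_row[of 0 n 0 s] by (simp add: offset_def height_def ramp_le_0)
    show False
    proof (cases "fst z > 0")
      case True
      then show False using left neg_offset off by (simp add: mult_less_0_iff)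
    next
      case False
      then show False using off z 1 bump_0 by (simp add: p_def)
    qed
  next
    \<comment> \<open>As \<open>11 * p > 121 / 12\<close> while \<open>2 + q * G \<le> 8\<close>,
      going up is descent, which only the top edge prevents.\<close>
    case 2
    have "q * G \<le> 3 * 2" using q0 q3 G by (intro mult_mono) auto
    then have "snd z = 1" using 2 up z by fastforce
    then show False using neg 2 by (simp add: p_def)
  qed
qed

section \<open>Counting queries\<close>

text \<open>Think of \<open>N \<omega>\<close> as a hitting time. By a union bound over the times,
  the sum of \<open>u\<close> up to \<open>N \<omega>\<close> stays below 1/2 on at most half of
  \<open>B\<close>; on the rest it is at least 1/2, so the mean is at least 1/4.\<close>

lemma stopped_weight_bound:
  fixes N :: "'a \<Rightarrow> nat" and u :: "nat \<Rightarrow> real"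
  assumes fin: "finite B" and u: "\<And>j. 0 \<le> u j"
    and hit: "\<And>j. real (card {\<omega>\<in>B. N \<omega> = j}) \<le> u j * real (card B)"
  shows "real (card B) / 4 \<le> (\<Sum>\<omega>\<in>B. \<Sum>j\<le>N \<omega>. u j)"
proof -
  define W where "W = (\<lambda>m. \<Sum>j\<le>m. u j)"
  define V where "V = {\<omega>\<in>B. W (N \<omega>) < 1 / 2}"
  have finV: "finite V" and "V \<subseteq> B" using fin by (auto simp: V_def)
  have "real (card V) \<le> real (card B) / 2"
  proof (cases "V = {}")
    case False
    define J where "J = Max (N ` V)"
    have "J \<in> N ` V" using False finV unfolding J_def by (intro Max_in) auto
    then have J: "W J < 1 / 2" by (auto simp: V_def)
    have "N \<omega> \<le> J" if "\<omega> \<in> V" for \<omega>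
      using that finV unfolding J_def by (intro Max_ge) auto
    then have "V \<subseteq> (\<Union>j\<le>J. {\<omega>\<in>B. N \<omega> = j})" using \<open>V \<subseteq> B\<close> by auto
    then have "card V \<le> card (\<Union>j\<le>J. {\<omega>\<in>B. N \<omega> = j})" using fin by (intro card_mono) auto
    also have "\<dots> \<le> (\<Sum>j\<le>J. card {\<omega>\<in>B. N \<omega> = j})" by (intro card_UN_le) auto
    finally have "real (card V) \<le> (\<Sum>j\<le>J. real (card {\<omega>\<in>B. N \<omega> = j}))"
      unfolding of_nat_sum[symmetric] by (rule of_nat_mono)
    also have "\<dots> \<le> (\<Sum>j\<le>J. u j * real (card B))" by (intro sum_mono hit)
    also have "\<dots> = W J * real (card B)" by (simp add: W_def sum_distrib_right)
    also have "\<dots> \<le> 1 / 2 * real (card B)" using J by (intro mult_right_mono) auto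
    finally show ?thesis by simp
  qed simp
  moreover have "real (card (B - V)) = real (card B) - real (card V)"
    using finV \<open>V \<subseteq> B\<close> fin by (simp add: card_Diff_subset card_mono of_nat_diff)
  ultimately have "real (card B) / 4 \<le> (\<Sum>\<omega>\<in>B - V. 1 / 2)" by simp
  also have "\<dots> \<le> (\<Sum>\<omega>\<in>B - V. W (N \<omega>))" by (intro sum_mono) (auto simp: V_def)
  also have "\<dots> \<le> (\<Sum>\<omega>\<in>B. W (N \<omega>))"
    using fin u by (intro sum_mono2) (auto simp: W_def intro: sum_nonneg)
  finally show ?thesis by (simp add: W_def)
qed

section \<open>Comparing the runs of an algorithm on two functions\<close>

text \<open>The output is treated like a query at the stopping time, and repeated afterwards, so
  that a hit by the output counts too.\<close>

definition visited :: "algorithm \<Rightarrow> (real \<times> real \<Rightarrow> real) \<Rightarrow> nat \<Rightarrow> real \<times> real" where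
  "visited A f j = (case A (answers A f j) of Query z \<Rightarrow> z | Output z \<Rightarrow> z)"

lemma visited_in_unit_square: "A \<in> det_algorithms \<Longrightarrow> visited A f j \<in> unit_square"
  unfolding det_algorithms_def visited_def by (auto split: action.splits)

lemma answers_cong:
  "(\<And>i. i < j \<Longrightarrow> f (visited A F i) = F (visited A F i)) \<Longrightarrow> answers A f j = answers A F j"
proof (induction j)
  case (Suc j)
  then have "answers A f j = answers A F j" by simp
  moreover have "f (visited A F j) = F (visited A F j)" using Suc.prems by simp
  ultimately show ?case by (auto simp: visited_def split: action.splits)
qed simp

text \<open>Runs with equal answers visit equal points, so without a difference up to time
  \<open>T\<close> the output \<open>x\<close> would itself be visited at time \<open>T\<close>. The
  point at step \<open>N\<close> is still common, being chosen from earlier answers.\<close>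

lemma first_difference:
  assumes stops: "stops_with A f T x" and ne: "f x \<noteq> F x"
  obtains N where "N \<le> T" "f (visited A F N) \<noteq> F (visited A F N)"
    "\<And>j. j \<le> N \<Longrightarrow> visited A f j = visited A F j"
proof -
  let ?P = "\<lambda>j. f (visited A F j) \<noteq> F (visited A F j)"
  have "\<exists>j\<le>T. ?P j"
  proof (rule ccontr)
    assume no: "\<not> ?thesis"
    then have "answers A f T = answers A F T" by (intro answers_cong) auto
    moreover have "A (answers A f T) = Output x" using stops by (simp add: stops_with_def)
    ultimately have "visited A F T = x" by (simp add: visited_def)
    then show False using no ne by auto
  qed
  then obtain j where j: "j \<le> T" "?P j" by blast
  have "answers A f i = answers A F i" if "i \<le> (LEAST j. ?P j)" for i
    using that not_less_Least[of _ ?P] by (intro answers_cong) (meson less_le_trans)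
  then show thesis
    using j LeastI[of ?P, OF j(2)] Least_le[of ?P, OF j(2)]
    by (intro that[of "LEAST j. ?P j"]) (auto simp: visited_def)
qed

definition baseline :: "real \<Rightarrow> real \<times> real \<Rightarrow> real" where
  "baseline \<epsilon> z = \<epsilon> * (2 * fst z + 2 * snd z)"

definition row :: "nat \<Rightarrow> real \<times> real \<Rightarrow> nat" where
  "row n z = nat \<lfloor>real n * snd z\<rfloor>"

text \<open>Up to height \<open>l\<close>, the ramps of the steps from \<open>l\<close> on have not
  started.\<close>

lemma landscape_prefix_cong:
  assumes "\<And>t. t < l \<Longrightarrow> s t = s' t" "real n * snd z \<le> real l"
  shows "landscape \<epsilon> n s z = landscape \<epsilon> n s' z"
proof -
  have "of_bool (s t) * ramp (real n * snd z - real t) = of_bool (s' t) * ramp (real n * snd z - real t)" for t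
    using assms by (cases "t < l") (auto simp: ramp_le_0)
  then have "curve n s (real n * snd z) = curve n s' (real n * snd z)"
    unfolding curve_def by (intro sum.cong refl)
  then show ?thesis by (simp add: landscape_def offset_def)
qed

lemma landscape_eq_baseline_iff:
  assumes "z \<in> unit_square" "\<epsilon> > 0"
  shows "landscape \<epsilon> n s z = baseline \<epsilon> z \<longleftrightarrow> bump (offset n s z) = 0"
  using assms by (auto simp: landscape_def baseline_def unit_square_iff)

text \<open>The curve exceeds \<open>height s (row n z)\<close> by at most 1 within the row, and the
  valley has half-width 1 in units of the mesh. This leaves three candidate heights, the source of
  the factor 3 in \<open>weight\<close>.\<close>

lemma height_near:
  assumes z: "z \<in> unit_square" and ne: "bump (offset n s z) \<noteq> 0"
  shows "int (height s (row n z)) \<in> {\<lfloor>real n * fst z\<rfloor> - 1 .. \<lfloor>real n * fst z\<rfloor> + 1}"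
proof -
  let ?y = "real n * snd z" and ?r = "row n z"
  have y: "0 \<le> ?y" "?y \<le> real n" using z by (auto simp: unit_square_iff mult_left_le)
  have r: "?r \<le> n" "real ?r \<le> ?y" "?y < real ?r + 1"
    using row_exists[OF y] by (simp_all add: row_def)
  have "curve n s ?y = real (height s ?r) + of_bool (s ?r) * ramp (?y - real ?r)"
    using r by (intro curve_row) auto
  moreover have "0 \<le> ramp (?y - real ?r) \<and> ramp (?y - real ?r) \<le> 1"
    using r by (intro ramp_bounds) auto
  ultimately have "real (height s ?r) \<le> curve n s ?y" "curve n s ?y \<le> real (height s ?r) + 1"
    by (auto simp: of_bool_def)
  moreover have "\<bar>real n * fst z - curve n s ?y\<bar> < 1"
    using ne bump_outside[of "offset n s z"] unfolding offset_def by linarith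
  ultimately have "real n * fst z - 2 < real (height s ?r)" "real (height s ?r) < real n * fst z + 1"
    by linarith+
  then show ?thesis by (simp; linarith)
qed

section \<open>Weights of the queries and their total\<close>

context unpredictable_family
begin

text \<open>Bounds the chance, given the first \<open>l\<close> steps, that a point in row
  \<open>r\<close> reveals more of the path: none below row \<open>l\<close>, the trivial 1 in row
  \<open>l\<close>, and three candidate heights beyond.\<close>

definition weight :: "nat \<Rightarrow> nat \<Rightarrow> real" where
  "weight l r = (if r < l then 0 else if r = l then 1 else 3 * (C / (real (r - l) * h (r - l))))"

lemma weight_nonneg: "0 \<le> weight l r"
  unfolding weight_def using C_pos h_pos[of "r - l"] by (auto simp: less_imp_le)

lemma sum_weight:
  assumes "r \<le> n"
  shows "(\<Sum>l<n. weight l r) \<le> 1 + 3 * C * S h n"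
proof -
  have "(\<Sum>l<n. weight l r) \<le> (\<Sum>l\<le>n. weight l r)"
    by (intro sum_mono2) (auto simp: weight_nonneg)
  also have "\<dots> = (\<Sum>l<r. weight l r) + weight r r + (\<Sum>l\<in>{r<..n}. weight l r)"
    by (rule sum_split_row[OF assms])
  also have "(\<Sum>l\<in>{r<..n}. weight l r) = 0" by (intro sum.neutral) (simp add: weight_def)
  also have "(\<Sum>l<r. weight l r) = (\<Sum>k=1..r. 3 * C * (1 / (real k * h k)))"
    by (rule sum.reindex_bij_witness[of _ "\<lambda>k. r - k" "\<lambda>l. r - l"]) (auto simp: weight_def)
  also have "\<dots> \<le> (\<Sum>k=1..n. 3 * C * (1 / (real k * h k)))"
    using assms C_pos h_pos by (intro sum_mono2) (auto simp: less_imp_le)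
  also have "\<dots> = 3 * C * S h n" by (simp add: S_def sum_distrib_left)
  finally show ?thesis by (simp add: weight_def)
qed

lemma bump_hit_card:
  assumes z: "z \<in> unit_square" and lr: "l < row n z"
  shows "real (card {\<omega>\<in>\<Omega>. (\<forall>t<l. s \<omega> t = v t) \<and> bump (offset n (s \<omega>) z) \<noteq> 0})
    \<le> weight l (row n z) * real (card {\<omega>\<in>\<Omega>. \<forall>t<l. s \<omega> t = v t})"
proof -
  let ?r = "row n z" and ?B = "{\<omega>\<in>\<Omega>. \<forall>t<l. s \<omega> t = v t}"
  define W where "W = {x. int x \<in> {\<lfloor>real n * fst z\<rfloor> - 1 .. \<lfloor>real n * fst z\<rfloor> + 1}}"
  have "int ` W \<subseteq> {\<lfloor>real n * fst z\<rfloor> - 1 .. \<lfloor>real n * fst z\<rfloor> + 1}" by (auto simp: W_def)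
  then have "finite (int ` W)" "card (int ` W) \<le> card {\<lfloor>real n * fst z\<rfloor> - 1 .. \<lfloor>real n * fst z\<rfloor> + 1}"
    using finite_subset card_mono[OF finite_atLeastAtMost_int] by blast+
  then have W: "finite W" "card W \<le> 3" by (auto simp: card_image finite_image_iff)
  have rn: "?r \<le> n"
    unfolding row_def using z by (intro row_exists) (auto simp: unit_square_iff mult_left_le)
  let ?c = "C / (real (?r - l) * h (?r - l)) * real (card ?B)"
  have "{\<omega>\<in>\<Omega>. (\<forall>t<l. s \<omega> t = v t) \<and> bump (offset n (s \<omega>) z) \<noteq> 0}
      \<subseteq> (\<Union>x\<in>W. {\<omega>\<in>\<Omega>. (\<forall>t<l. s \<omega> t = v t) \<and> height (s \<omega>) ?r = x})"
    using height_near[OF z] by (auto simp: W_def)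
  then have "card {\<omega>\<in>\<Omega>. (\<forall>t<l. s \<omega> t = v t) \<and> bump (offset n (s \<omega>) z) \<noteq> 0}
      \<le> card (\<Union>x\<in>W. {\<omega>\<in>\<Omega>. (\<forall>t<l. s \<omega> t = v t) \<and> height (s \<omega>) ?r = x})"
    using finite_family W by (intro card_mono) auto
  also have "\<dots> \<le> (\<Sum>x\<in>W. card {\<omega>\<in>\<Omega>. (\<forall>t<l. s \<omega> t = v t) \<and> height (s \<omega>) ?r = x})"
    using W by (intro card_UN_le)
  finally have "real (card {\<omega>\<in>\<Omega>. (\<forall>t<l. s \<omega> t = v t) \<and> bump (offset n (s \<omega>) z) \<noteq> 0})
      \<le> (\<Sum>x\<in>W. real (card {\<omega>\<in>\<Omega>. (\<forall>t<l. s \<omega> t = v t) \<and> height (s \<omega>) ?r = x}))"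
    unfolding of_nat_sum[symmetric] by (rule of_nat_mono)
  also have "\<dots> \<le> (\<Sum>x\<in>W. ?c)"
    using lr rn by (intro sum_mono unpredictable)
  also have "\<dots> = real (card W) * ?c" by simp
  also have "\<dots> \<le> 3 * ?c"
    using W C_pos h_pos[of "?r - l"] lr by (intro mult_right_mono) (auto simp: less_imp_le)
  finally show ?thesis using lr by (simp add: weight_def)
qed

context
  fixes A :: algorithm and \<epsilon> :: real and T :: "'w \<Rightarrow> nat" and X :: "'w \<Rightarrow> real \<times> real"
  assumes A: "A \<in> det_algorithms" and eps: "\<epsilon> > 0" and n20: "20 \<le> n"
    and stops: "\<And>\<omega>. \<omega> \<in> \<Omega> \<Longrightarrow> stops_with A (landscape \<epsilon> n (s \<omega>)) (T \<omega>) (X \<omega>)"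
    and stationary: "\<And>\<omega>. \<omega> \<in> \<Omega> \<Longrightarrow> stationary_point \<epsilon> (landscape \<epsilon> n (s \<omega>)) (X \<omega>)"
begin

lemma prefix_class_weight:
  assumes l: "l < n" and w0: "\<omega>\<^sub>0 \<in> \<Omega>"
  defines "B \<equiv> {\<omega>\<in>\<Omega>. \<forall>t<l. s \<omega> t = s \<omega>\<^sub>0 t}"
  shows "real (card B) / 4
    \<le> (\<Sum>\<omega>\<in>B. \<Sum>j\<le>T \<omega>. weight l (row n (visited A (landscape \<epsilon> n (s \<omega>)) j)))"
proof -
  let ?f = "\<lambda>\<omega>. landscape \<epsilon> n (s \<omega>)"
  \<comment> \<open>As long as nothing beyond row \<open>l\<close> has been discovered, the algorithm behaves on every member of
    the class \<open>B\<close> as on this single oracle, in which the valley ends at row \<open>l\<close>.\<close>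
  define F where "F = (\<lambda>z. if real n * snd z \<le> real l then ?f \<omega>\<^sub>0 z else baseline \<epsilon> z)"
  define u where "u = (\<lambda>j. weight l (row n (visited A F j)))"
  have finB: "finite B" using finite_family by (simp add: B_def)
  \<comment> \<open>A difference must be met by time \<open>T \<omega>\<close>: the output lies in
    the valley on the top edge, beyond row \<open>l\<close>, where \<open>F\<close> is the
    plane.\<close>
  have "\<exists>N. N \<le> T \<omega> \<and> ?f \<omega> (visited A F N) \<noteq> F (visited A F N) \<and>
      (\<forall>j\<le>N. visited A (?f \<omega>) j = visited A F j)" if "\<omega> \<in> B" for \<omega>
  proof -
    have w: "\<omega> \<in> \<Omega>" using that by (simp add: B_def)
    have "snd (X \<omega>) = 1" "bump (offset n (s \<omega>) (X \<omega>)) > 0"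
      using landscape_stationary[OF stationary[OF w] eps n20] by auto
    moreover have "X \<omega> \<in> unit_square" using stationary[OF w] by (simp add: stationary_point_def)
    ultimately have "?f \<omega> (X \<omega>) \<noteq> F (X \<omega>)"
      using l eps by (simp add: F_def landscape_eq_baseline_iff)
    from first_difference[of A "?f \<omega>" "T \<omega>" "X \<omega>" F, OF stops[OF w] this] show ?thesis by metis
  qed
  then obtain N where N: "\<And>\<omega>. \<omega> \<in> B \<Longrightarrow> N \<omega> \<le> T \<omega>"
    "\<And>\<omega>. \<omega> \<in> B \<Longrightarrow> ?f \<omega> (visited A F (N \<omega>)) \<noteq> F (visited A F (N \<omega>))"
    "\<And>\<omega> j. \<omega> \<in> B \<Longrightarrow> j \<le> N \<omega> \<Longrightarrow> visited A (?f \<omega>) j = visited A F j"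
    by metis
  have "real (card B) / 4 \<le> (\<Sum>\<omega>\<in>B. \<Sum>j\<le>N \<omega>. u j)"
  proof (rule stopped_weight_bound[OF finB])
    show "0 \<le> u j" for j by (simp add: u_def weight_nonneg)
  next
    fix j
    define z where "z = visited A F j"
    have z: "z \<in> unit_square" unfolding z_def by (rule visited_in_unit_square[OF A])
    have hits: "{\<omega>\<in>B. N \<omega> = j} \<subseteq> {\<omega>\<in>B. ?f \<omega> z \<noteq> F z}" using N(2) by (auto simp: z_def)
    have uz: "u j = weight l (row n z)" by (simp add: u_def z_def)
    have yrow: "real (row n z) \<le> real n * snd z" "real n * snd z < real (row n z) + 1"
      using row_exists(2,3)[of "real n * snd z" n] z by (auto simp: row_def unit_square_iff mult_left_le)
    show "real (card {\<omega>\<in>B. N \<omega> = j}) \<le> u j * real (card B)"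
    proof (cases "row n z" l rule: linorder_cases)
      case less
      then have "real n * snd z \<le> real l" using yrow by linarith
      then have "?f \<omega> z = F z" if "\<omega> \<in> B" for \<omega>
        using that landscape_prefix_cong[of l "s \<omega>" "s \<omega>\<^sub>0" n z \<epsilon>] by (simp add: F_def B_def)
      then have none: "{\<omega>\<in>B. N \<omega> = j} = {}" using hits by auto
      show ?thesis unfolding none uz using weight_nonneg by simp
    next
      \<comment> \<open>Within row \<open>l\<close> the valley depends, beyond the known past, on
        the single step \<open>l\<close>, so a hit can be likely; the trivial bound 1 is
        used.\<close>
      case equal
      have "card {\<omega>\<in>B. N \<omega> = j} \<le> card B" using finB by (intro card_mono) auto
      then show ?thesis using uz equal by (simp add: weight_def)
    next
      case greater
      then have "\<not> real n * snd z \<le> real l" using yrow by linarith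
      then have "{\<omega>\<in>B. N \<omega> = j} \<subseteq> {\<omega>\<in>\<Omega>. (\<forall>t<l. s \<omega> t = s \<omega>\<^sub>0 t) \<and> bump (offset n (s \<omega>) z) \<noteq> 0}"
        using hits z eps by (auto simp: F_def landscape_eq_baseline_iff B_def)
      then have "card {\<omega>\<in>B. N \<omega> = j}
          \<le> card {\<omega>\<in>\<Omega>. (\<forall>t<l. s \<omega> t = s \<omega>\<^sub>0 t) \<and> bump (offset n (s \<omega>) z) \<noteq> 0}"
        using finite_family by (intro card_mono) auto
      then show ?thesis
        using bump_hit_card[OF z greater, of "s \<omega>\<^sub>0"] unfolding uz B_def
        by (meson of_nat_mono order_trans)
    qed
  qed
  also have "\<dots> \<le> (\<Sum>\<omega>\<in>B. \<Sum>j\<le>T \<omega>. weight l (row n (visited A (?f \<omega>) j)))"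
  proof (rule sum_mono)
    fix \<omega> assume w: "\<omega> \<in> B"
    have "(\<Sum>j\<le>N \<omega>. u j) = (\<Sum>j\<le>N \<omega>. weight l (row n (visited A (?f \<omega>) j)))"
      using N(3)[OF w] by (intro sum.cong) (simp_all add: u_def)
    also have "\<dots> \<le> (\<Sum>j\<le>T \<omega>. weight l (row n (visited A (?f \<omega>) j)))"
      using N(1)[OF w] by (intro sum_mono2) (auto simp: weight_nonneg)
    finally show "(\<Sum>j\<le>N \<omega>. u j) \<le> (\<Sum>j\<le>T \<omega>. weight l (row n (visited A (?f \<omega>) j)))" .
  qed
  finally show ?thesis .
qed

lemma total_weight:
  assumes l: "l < n"
  shows "real (card \<Omega>) / 4
    \<le> (\<Sum>\<omega>\<in>\<Omega>. \<Sum>j\<le>T \<omega>. weight l (row n (visited A (landscape \<epsilon> n (s \<omega>)) j)))" (is "_ \<le> sum ?g \<Omega>")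
proof -
  \<comment> \<open>The first \<open>l\<close> steps, padded with \<open>False\<close>, label the
    prefix classes that partition \<open>\<Omega>\<close>.\<close>
  define \<pi> where "\<pi> = (\<lambda>\<omega> t. t < l \<and> s \<omega> t)"
  have "(\<Sum>\<omega>\<in>\<Omega>. 1 / 4) = (\<Sum>p\<in>\<pi> ` \<Omega>. \<Sum>\<omega>\<in>{\<omega>\<in>\<Omega>. \<pi> \<omega> = p}. 1 / 4 :: real)"
    by (rule sum.image_gen[OF finite_family])
  also have "\<dots> \<le> (\<Sum>p\<in>\<pi> ` \<Omega>. sum ?g {\<omega>\<in>\<Omega>. \<pi> \<omega> = p})"
  proof (rule sum_mono)
    fix p assume "p \<in> \<pi> ` \<Omega>"
    then obtain \<omega>\<^sub>0 where w0: "\<omega>\<^sub>0 \<in> \<Omega>" "p = \<pi> \<omega>\<^sub>0" by blast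
    have eq: "{\<omega>\<in>\<Omega>. \<pi> \<omega> = p} = {\<omega>\<in>\<Omega>. \<forall>t<l. s \<omega> t = s \<omega>\<^sub>0 t}"
      unfolding w0(2) \<pi>_def by (auto simp: fun_eq_iff)
    show "(\<Sum>\<omega>\<in>{\<omega>\<in>\<Omega>. \<pi> \<omega> = p}. 1 / 4) \<le> sum ?g {\<omega>\<in>\<Omega>. \<pi> \<omega> = p}"
      unfolding eq using prefix_class_weight[OF l w0(1)] by simp
  qed
  also have "\<dots> = sum ?g \<Omega>" by (rule sum.image_gen[OF finite_family, symmetric])
  finally show ?thesis by simp
qed

text \<open>Double counting: every level \<open>l\<close> demands total weight
  \<open>card \<Omega> / 4\<close>, and every visited point supplies at most
  \<open>1 + 3 * C * S h n\<close> over all levels. The 1 added to \<open>T \<omega>\<close> is the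
  output.\<close>

lemma total_queries:
  "real n * real (card \<Omega>) / 4 \<le> (1 + 3 * C * S h n) * (\<Sum>\<omega>\<in>\<Omega>. real (T \<omega>) + 1)"
proof -
  let ?r = "\<lambda>\<omega> j. row n (visited A (landscape \<epsilon> n (s \<omega>)) j)"
  have rn: "?r \<omega> j \<le> n" for \<omega> j
    unfolding row_def using visited_in_unit_square[OF A]
    by (intro row_exists) (auto simp: unit_square_iff mult_left_le)
  have "real n * real (card \<Omega>) / 4 = (\<Sum>l<n. real (card \<Omega>) / 4)" by simp
  also have "\<dots> \<le> (\<Sum>l<n. \<Sum>\<omega>\<in>\<Omega>. \<Sum>j\<le>T \<omega>. weight l (?r \<omega> j))"
    by (intro sum_mono total_weight) simp
  also have "\<dots> = (\<Sum>\<omega>\<in>\<Omega>. \<Sum>l<n. \<Sum>j\<le>T \<omega>. weight l (?r \<omega> j))"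
    by (rule sum.swap)
  also have "\<dots> = (\<Sum>\<omega>\<in>\<Omega>. \<Sum>j\<le>T \<omega>. \<Sum>l<n. weight l (?r \<omega> j))"
    by (intro sum.cong refl sum.swap)
  also have "\<dots> \<le> (\<Sum>\<omega>\<in>\<Omega>. \<Sum>j\<le>T \<omega>. 1 + 3 * C * S h n)"
    by (intro sum_mono sum_weight rn)
  also have "\<dots> = (1 + 3 * C * S h n) * (\<Sum>\<omega>\<in>\<Omega>. real (T \<omega>) + 1)"
    unfolding sum_distrib_left by (intro sum.cong refl) (simp add: mult.commute add.commute)
  finally show ?thesis .
qed

end

end

section \<open>From deterministic to randomized algorithms\<close>

text \<open>The easy direction of Yao's principle: a supremum over smooth functions is at least the
  average over the family, and expectation commutes with the finite sum.\<close>

lemma Q_rand_ge_average: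
  assumes fin: "finite \<Omega>" and ne: "\<Omega> \<noteq> {}" and c: "0 \<le> c"
    and smooth: "\<And>\<omega>. \<omega> \<in> \<Omega> \<Longrightarrow> smooth (f \<omega>)"
    and cost: "\<And>A. A \<in> det_algorithms \<Longrightarrow>
      ennreal (real (card \<Omega>) * c) \<le> (\<Sum>\<omega>\<in>\<Omega>. query_cost A (f \<omega>) \<epsilon>)"
  shows "ennreal c \<le> Q_rand \<epsilon>"
  unfolding Q_rand_def
proof (rule INF_greatest)
  fix M assume M: "M \<in> rand_algorithms \<epsilon>"
  then interpret prob_space M by (simp add: rand_algorithms_def)
  have meas: "(\<lambda>A. query_cost A (f \<omega>) \<epsilon>) \<in> borel_measurable M" if "\<omega> \<in> \<Omega>" for \<omega>
    using M smooth[OF that] by (simp add: rand_algorithms_def)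
  let ?V = "SUP f\<in>{f. smooth f}. \<integral>\<^sup>+A. query_cost A f \<epsilon> \<partial>M"
  have "of_nat (card \<Omega>) * ennreal c = (\<integral>\<^sup>+A. ennreal (real (card \<Omega>) * c) \<partial>M)"
    using c by (simp add: emeasure_space_1 ennreal_mult' ennreal_of_nat_eq_real_of_nat)
  also have "\<dots> \<le> (\<integral>\<^sup>+A. (\<Sum>\<omega>\<in>\<Omega>. query_cost A (f \<omega>) \<epsilon>) \<partial>M)"
    using M by (intro nn_integral_mono cost) (auto simp: rand_algorithms_def)
  also have "\<dots> = (\<Sum>\<omega>\<in>\<Omega>. \<integral>\<^sup>+A. query_cost A (f \<omega>) \<epsilon> \<partial>M)"
    by (intro nn_integral_sum meas)
  also have "\<dots> \<le> (\<Sum>\<omega>\<in>\<Omega>. ?V)"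
    using smooth by (intro sum_mono SUP_upper) auto
  finally have "of_nat (card \<Omega>) * ennreal c \<le> of_nat (card \<Omega>) * ?V" by simp
  moreover have "card \<Omega> > 0" using fin ne by (simp add: card_gt_0_iff)
  ultimately show "ennreal c \<le> ?V"
    by (subst (asm) ennreal_mult_le_mult_iff) auto
qed

lemma query_cost_eq:
  assumes "stops_with A f n x" "stationary_point \<epsilon> f x"
  shows "query_cost A f \<epsilon> = of_nat n"
proof -
  have "{of_nat m :: ennreal | m y. stops_with A f m y \<and> stationary_point \<epsilon> f y} = {of_nat n}"
    using assms stops_with_unique by blast
  then show ?thesis by (simp add: query_cost_def)
qed

lemma query_cost_infinite:
  assumes "\<nexists>n x. stops_with A f n x \<and> stationary_point \<epsilon> f x"
  shows "query_cost A f \<epsilon> = \<infinity>"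
proof -
  have "{of_nat m :: ennreal | m y. stops_with A f m y \<and> stationary_point \<epsilon> f y} = {}"
    using assms by blast
  then show ?thesis unfolding query_cost_def by (simp only: Inf_empty infinity_ennreal_def)
qed

text \<open>With \<open>K = 1 + 3 * C * S h n\<close>, \<open>total_queries\<close> gives a mean of
  \<open>T \<omega> + 1\<close> of at least \<open>n / (4 * K)\<close>; by \<open>large\<close> the
  1 is at most half of that.\<close>

lemma (in unpredictable_family) Q_rand_lower_bound:
  assumes eps: "\<epsilon> > 0" and n: "20 \<le> n" "1600 * \<epsilon> * (real n)\<^sup>2 \<le> 1"
    and large: "8 * (1 + 3 * C * S h n) \<le> real n"
  shows "ennreal (real n / (8 * (1 + 3 * C * S h n))) \<le> Q_rand \<epsilon>"
proof -
  define K where "K = 1 + 3 * C * S h n"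
  have "0 \<le> S h n" unfolding S_def using h_pos by (intro sum_nonneg) (auto simp: less_imp_le)
  then have K: "K \<ge> 1" unfolding K_def using C_pos by simp
  have "ennreal (real n / (8 * K)) \<le> Q_rand \<epsilon>"
  proof (rule Q_rand_ge_average[OF finite_family nonempty, where f = "\<lambda>\<omega>. landscape \<epsilon> n (s \<omega>)"])
    show "0 \<le> real n / (8 * K)" using K by simp
    show "smooth (landscape \<epsilon> n (s \<omega>))" for \<omega> using n eps by (intro smooth_landscape) auto
  next
    fix A assume A: "A \<in> det_algorithms"
    show "ennreal (real (card \<Omega>) * (real n / (8 * K))) \<le> (\<Sum>\<omega>\<in>\<Omega>. query_cost A (landscape \<epsilon> n (s \<omega>)) \<epsilon>)"
    proof (cases "\<forall>\<omega>\<in>\<Omega>. \<exists>T X. stops_with A (landscape \<epsilon> n (s \<omega>)) T X \<and> stationary_point \<epsilon> (landscape \<epsilon> n (s \<omega>)) X")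
      case True
      then obtain T X where TX: "\<And>\<omega>. \<omega> \<in> \<Omega> \<Longrightarrow> stops_with A (landscape \<epsilon> n (s \<omega>)) (T \<omega>) (X \<omega>)"
        "\<And>\<omega>. \<omega> \<in> \<Omega> \<Longrightarrow> stationary_point \<epsilon> (landscape \<epsilon> n (s \<omega>)) (X \<omega>)"
        by metis
      let ?m = "real (card \<Omega>)" and ?t = "\<Sum>\<omega>\<in>\<Omega>. real (T \<omega>)"
      have "real n * ?m / 4 \<le> K * (\<Sum>\<omega>\<in>\<Omega>. real (T \<omega>) + 1)"
        using total_queries[OF A eps n(1) TX] by (simp add: K_def)
      also have "\<dots> = K * ?t + K * ?m" by (simp add: sum.distrib distrib_left)
      also have "K * ?m \<le> real n / 8 * ?m" using large by (intro mult_right_mono) (auto simp: K_def)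
      finally have "real n * ?m \<le> 8 * (K * ?t)" by (simp add: field_simps)
      then have "?m * (real n / (8 * K)) \<le> ?t" using K by (simp add: field_simps)
      then have "ennreal (?m * (real n / (8 * K))) \<le> ennreal ?t" by (rule ennreal_leI)
      also have "\<dots> = (\<Sum>\<omega>\<in>\<Omega>. query_cost A (landscape \<epsilon> n (s \<omega>)) \<epsilon>)"
      proof -
        have "ennreal ?t = (\<Sum>\<omega>\<in>\<Omega>. of_nat (T \<omega>))"
          by (simp add: ennreal_of_nat_eq_real_of_nat)
        also have "\<dots> = (\<Sum>\<omega>\<in>\<Omega>. query_cost A (landscape \<epsilon> n (s \<omega>)) \<epsilon>)"
          using query_cost_eq[OF TX] by (intro sum.cong) simp_all
        finally show ?thesis .
      qed
      finally show ?thesis .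
    next
      case False
      then obtain \<omega> where "\<omega> \<in> \<Omega>" "query_cost A (landscape \<epsilon> n (s \<omega>)) \<epsilon> = \<infinity>"
        using query_cost_infinite by metis
      moreover have "query_cost A (landscape \<epsilon> n (s \<omega>)) \<epsilon>
          \<le> (\<Sum>\<omega>\<in>\<Omega>. query_cost A (landscape \<epsilon> n (s \<omega>)) \<epsilon>)"
        using \<open>\<omega> \<in> \<Omega>\<close> finite_family by (intro member_le_sum) auto
      ultimately show ?thesis by (simp add: top_unique)
    qed
  qed
  then show ?thesis by (simp add: K_def)
qed

section \<open>Choice of the parameters\<close>

lemma sum_inverse_sqrt_le: "(\<Sum>k=1..n. 1 / sqrt (real k)) \<le> 2 * sqrt (real n)"
proof (induction n)
  case (Suc n)
  define a b where "a = sqrt (real n)" and "b = sqrt (real (Suc n))"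
  have ab: "0 \<le> a" "a \<le> b" "b > 0" "b * b = a * a + 1"
    by (simp_all add: a_def b_def)
  have "1 = (b - a) * (b + a)" using ab(4) by (simp add: algebra_simps)
  also have "\<dots> \<le> (b - a) * (2 * b)" using ab by (intro mult_left_mono) auto
  finally have "1 / b \<le> 2 * (b - a)" using ab(3) by (simp add: field_simps)
  then show ?case using Suc by (simp add: a_def b_def)
qed simp

text \<open>Cauchy condensation, where the factor \<open>2 ^ j\<close> cancels the
  denominator.\<close>

lemma summable_condensed:
  fixes h :: "nat \<Rightarrow> real"
  assumes pos: "\<And>k. 1 \<le> k \<Longrightarrow> 0 < h k"
    and dec: "\<And>k l. 1 \<le> k \<Longrightarrow> k \<le> l \<Longrightarrow> h l \<le> h k"
    and summ: "summable (\<lambda>k. h (Suc k) / real (Suc k))"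
  shows "summable (\<lambda>j. h (2 ^ j))"
proof -
  have "summable (\<lambda>k. h k / real k)"
    using summ summable_Suc_iff[of "\<lambda>k. h k / real k"] by simp
  moreover have "summable (\<lambda>k. h k / real k) \<longleftrightarrow> summable (\<lambda>j. 2 ^ j * (h (2 ^ j) / real (2 ^ j)))"
  proof (rule condensation_test)
    show "h (Suc m) / real (Suc m) \<le> h m / real m" if "0 < m" for m
      using that pos[of m] dec[of m "Suc m"] by (intro frac_le) (auto intro: less_imp_le)
    show "0 \<le> h m / real m" for m
      using pos[of m] by (cases "m = 0") (auto simp: less_imp_le)
  qed
  ultimately show ?thesis by simp
qed

theorem theorem4:
  fixes h :: "nat \<Rightarrow> real"
  assumes h_pos: "\<And>k. 1 \<le> k \<Longrightarrow> 0 < h k"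
    and h_decreasing: "\<And>k l. 1 \<le> k \<Longrightarrow> k \<le> l \<Longrightarrow> h l \<le> h k"
    and h_summable: "summable (\<lambda>k. h (Suc k) / real (Suc k))"
  shows "\<exists>c>0. \<exists>\<epsilon>\<^sub>0>0. \<forall>\<epsilon>::real. 0 < \<epsilon> \<and> \<epsilon> < \<epsilon>\<^sub>0 \<longrightarrow>
           ennreal (c / (sqrt \<epsilon> * S h (nat \<lceil>1 / sqrt \<epsilon>\<rceil>))) \<le> Q_rand \<epsilon>"
proof -
  \<comment> \<open>Raising \<^term>\<open>h\<close> only strengthens the bound; the extra summand gives
    \<^term>\<open>S g n \<le> 2 * sqrt n\<close>, so that the output, counted as one more query, can be absorbed.\<close>
  define g where "g = (\<lambda>k. h k + 1 / sqrt (real k))"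
  have g_pos: "0 < g k" if "1 \<le> k" for k
    using h_pos[OF that] that by (simp add: g_def add_pos_pos)
  have g_dec: "g l \<le> g k" if "1 \<le> k" "k \<le> l" for k l
    unfolding g_def using h_decreasing[OF that] that by (intro add_mono frac_le) auto
  have "summable (\<lambda>j. h (2 ^ j))"
    by (rule summable_condensed[OF h_pos h_decreasing h_summable])
  moreover have "summable (\<lambda>j. 1 / sqrt (real (2 ^ j)))"
  proof -
    have "summable (\<lambda>j. (1 / sqrt 2) ^ j)" by (intro summable_geometric) simp
    then show ?thesis by (simp add: real_sqrt_power power_one_over)
  qed
  ultimately have "summable (\<lambda>j. g (2 ^ j))"
    unfolding g_def by (rule summable_add)
  then obtain C where "C > 0" and
    paths: "\<And>n. \<exists>(\<Omega> :: (nat \<times> nat \<Rightarrow> nat) set) s. unpredictable_family \<Omega> s C g n"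
    using unpredictable_paths[of g] g_pos g_dec by blast
  \<comment> \<open>The first term of \<open>S g n\<close> is \<open>1 / g 1\<close>, so the
    additive 1 in \<open>1 + 3 * C * S g n\<close> is at most \<open>g 1 * S g n\<close>.\<close>
  define K where "K = g 1 + 3 * C"
  have K: "K > 0" using g_pos[of 1] \<open>C > 0\<close> by (simp add: K_def)
  have Sg_mono: "S g m \<le> S h k" if "m \<le> k" for m k
  proof -
    have "S g m \<le> S h m"
      unfolding S_def using h_pos by (intro sum_mono frac_le mult_left_mono) (auto simp: g_def)
    also have "\<dots> \<le> S h k"
      unfolding S_def using that h_pos by (intro sum_mono2) (auto simp: less_imp_le)
    finally show ?thesis .
  qed
  have Sg_sqrt: "S g m \<le> 2 * sqrt (real m)" for m
  proof -
    have "S g m \<le> (\<Sum>k=1..m. 1 / sqrt (real k))"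
      unfolding S_def
    proof (rule sum_mono)
      fix k assume k: "k \<in> {1..m}"
      have "sqrt (real k) = real k * (1 / sqrt (real k))"
        using k by (simp add: real_div_sqrt)
      also have "\<dots> \<le> real k * g k"
        using k h_pos[of k] by (intro mult_left_mono) (auto simp: g_def)
      finally show "1 / (real k * g k) \<le> 1 / sqrt (real k)"
        using k by (intro frac_le) auto
    qed
    also have "\<dots> \<le> 2 * sqrt (real m)" by (rule sum_inverse_sqrt_le)
    finally show ?thesis .
  qed
  \<comment> \<open>From \<open>M \<le> n\<close> follow \<open>20 \<le> n\<close> and, as
    \<open>256 * K\<^sup>2 = (16 * K)\<^sup>2\<close>, \<open>16 * K \<le> sqrt n\<close>; with
    \<open>Sg_sqrt\<close> this yields \<open>8 * (K * S g n) \<le> n\<close>.\<close>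
  define M where "M = 20 + 256 * K\<^sup>2"
  have M: "M \<ge> 20" by (simp add: M_def)
  \<comment> \<open>\<open>640 = 80 * 8\<close>, with 80 from
    \<open>1 / (80 * \<rho>) \<le> n\<close> and 8 from \<open>Q_rand_lower_bound\<close>.\<close>
  have bound: "ennreal (1 / (640 * K) / (sqrt \<epsilon> * S h (nat \<lceil>1 / sqrt \<epsilon>\<rceil>))) \<le> Q_rand \<epsilon>"
    if eps: "0 < \<epsilon>" "\<epsilon> < (1 / (80 * M))\<^sup>2" for \<epsilon>
  proof -
    define \<rho> where "\<rho> = sqrt \<epsilon>"
    have rho: "\<rho> > 0" "\<rho> * \<rho> = \<epsilon>" using eps by (simp_all add: \<rho>_def)
    have "\<rho> < 1 / (80 * M)"
      unfolding \<rho>_def using eps M by (intro real_less_lsqrt) auto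
    then have big: "M < 1 / (80 * \<rho>)" using rho M by (simp add: field_simps)
    \<comment> \<open>The finest mesh with \<open>1600 * \<epsilon> * n\<^sup>2 \<le> 1\<close>;
      rounding down loses at most a factor 2 because \<open>1 / (80 * \<rho>)\<close> exceeds
      \<open>M \<ge> 20\<close>.\<close>
    define n where "n = nat \<lfloor>1 / (40 * \<rho>)\<rfloor>"
    have half: "1 / (40 * \<rho>) = 2 * (1 / (80 * \<rho>))" by simp
    have n: "real n \<le> 1 / (40 * \<rho>)" "1 / (80 * \<rho>) \<le> real n"
      using big M half unfolding n_def by linarith+
    have nM: "M \<le> real n" using n big by linarith
    have n20: "20 \<le> n" using nM M by linarith
    have "(real n * \<rho>) * (real n * \<rho>) \<le> (1 / 40) * (1 / 40)"
      using n(1) rho by (intro mult_mono) (auto simp: field_simps)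
    then have n2: "1600 * \<epsilon> * (real n)\<^sup>2 \<le> 1"
      using rho(2) by (simp add: power2_eq_square algebra_simps flip: rho(2))
    have "1 / g 1 \<le> S g n"
    proof -
      have "1 / (real 1 * g 1) \<le> S g n"
        unfolding S_def using n20 g_pos
        by (intro member_le_sum[of 1 "{1..n}" "\<lambda>k. 1 / (real k * g k)"]) (auto simp: less_imp_le)
      then show ?thesis by simp
    qed
    moreover have "0 < 1 / g 1" using g_pos[of 1] by simp
    ultimately have Sg: "S g n > 0" "1 \<le> g 1 * S g n"
      using g_pos[of 1] by (linarith, simp add: divide_le_eq mult.commute)
    then have KS: "1 + 3 * C * S g n \<le> K * S g n" by (simp add: K_def distrib_right)
    have pos: "1 + 3 * C * S g n > 0" using Sg \<open>C > 0\<close> by (simp add: add_pos_pos)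
    have "16 * K \<le> sqrt (real n)"
      using nM K by (intro real_le_rsqrt) (simp add: M_def power_mult_distrib)
    then have "16 * K * sqrt (real n) \<le> sqrt (real n) * sqrt (real n)"
      by (intro mult_right_mono) auto
    moreover have "8 * (K * S g n) \<le> 8 * (K * (2 * sqrt (real n)))"
      using Sg_sqrt K by (intro mult_left_mono) auto
    ultimately have large: "8 * (K * S g n) \<le> real n" by simp
    obtain \<Omega> :: "(nat \<times> nat \<Rightarrow> nat) set" and s where "unpredictable_family \<Omega> s C g n"
      using paths by blast
    then interpret unpredictable_family \<Omega> s C g n .
    have "n \<le> nat \<lceil>1 / \<rho>\<rceil>"
    proof -
      have "1 / (40 * \<rho>) \<le> 1 / \<rho>" using rho by (intro frac_le) auto
      then show ?thesis using n(1) by linarith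
    qed
    then have Sle: "S g n \<le> S h (nat \<lceil>1 / \<rho>\<rceil>)" by (rule Sg_mono)
    have "1 / (640 * K) / (\<rho> * S h (nat \<lceil>1 / \<rho>\<rceil>)) \<le> 1 / (640 * K) / (\<rho> * S g n)"
      using Sle Sg K rho by (intro divide_left_mono mult_left_mono mult_pos_pos) auto
    also have "\<dots> = 1 / (80 * \<rho>) / (8 * (K * S g n))" by simp
    also have "\<dots> \<le> real n / (8 * (1 + 3 * C * S g n))"
      using n(2) KS pos rho by (intro frac_le) auto
    finally have "ennreal (1 / (640 * K) / (\<rho> * S h (nat \<lceil>1 / \<rho>\<rceil>)))
        \<le> ennreal (real n / (8 * (1 + 3 * C * S g n)))" by (rule ennreal_leI)
    also have "\<dots> \<le> Q_rand \<epsilon>"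
      using order_trans[OF mult_left_mono[OF KS, of 8] large]
      by (intro Q_rand_lower_bound eps(1) n20 n2) simp
    finally show ?thesis by (simp add: \<rho>_def)
  qed
  show ?thesis
    using bound K M by (intro exI[of _ "1 / (640 * K)"] exI[of _ "(1 / (80 * M))\<^sup>2"] conjI) auto
qed

end
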